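(* Let $\Phi:M_2(\mathbb{C})\to M_2(\mathbb{C})$ be a completely positive and trace-preserving linear map for which there exists a state $\rho_\infty=\begin{pmatrix}\alpha_\infty & \beta_\infty\\ \overline{\beta}_\infty & 1-\alpha_\infty\end{pmatrix}$ such that for any given state $\rho$, $$\Phi^n(\rho)=\rho_\infty+o(1)\quad(n\to\infty).$$ Put $v=(v_1,v_2,v_3)$ with $v_1=2\,\mathrm{Re}(\beta_\infty)$, $v_2=-2\,\mathrm{Im}(\beta_\infty)$, $v_3=2\alpha_\infty-1$. Let $\rho$ be a state, and let $\omega=\rho\otimes\Phi(\rho)\otimes\Phi^2(\rho)\otimes\cdots$ and $\bar X_n,\bar Y_n,\bar Z_n$ be as defined in the context. Then for every $\nu=(\nu_1,\nu_2,\nu_3)\in\mathbb{R}^3\setminus\{0\}$, the sequence $$\left(\frac{\nu_1\bar X_n+\nu_2\bar Y_n+\nu_3\bar Z_n}{n}\right)_{n\ge1}$$ (of observables considered under the state $\omega$) satisfies a large deviation principle with speed $n$ and the good rate function $$I(x)=\begin{cases}\dfrac12\left[\left(1+\dfrac{x}{\|\nu\|}\right)\log\left(\dfrac{\|\nu\|+x}{\|\nu\|+\langle\nu,v\rangle}\right)+\left(1-\dfrac{x}{\|\nu\|}\right)\log\left(\dfrac{\|\nu\|-x}{\|\nu\|-\langle\nu,v\rangle}\right)\right] & \text{if } |x|<\|\nu\|,\\[2mm] +\infty & \text{otherwise.}\end{cases}$$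
   Context: A state on $M_2(\mathbb{C})$ is identified with a density matrix $\rho$ (positive semi-definite, trace one), acting by $A\mapsto \mathrm{Trace}(A\rho)$. The Pauli matrices are $$\sigma_x=\begin{pmatrix}0&1\\1&0\end{pmatrix},\quad \sigma_y=\begin{pmatrix}0&-i\\ i&0\end{pmatrix},\quad \sigma_z=\begin{pmatrix}1&0\\0&-1\end{pmatrix}.$$ Let $M_1,M_2,\dots$ be copies of $M_2(\mathbb{C})$ and consider the infinite tensor product algebra $M_1\otimes M_2\otimes\cdots$ (in the sense of $W^*$-algebras) with respect to the product state $\omega=\rho\otimes\Phi(\rho)\otimes\Phi^2(\rho)\otimes\cdots$, so the $k$-th factor ($k\ge1$) carries the state $\Phi^{k-1}(\rho)$. Thus $\omega[A_1\otimes\cdots\otimes A_N\otimes I\otimes I\otimes\cdots]=\prod_{k=1}^N\mathrm{Trace}(A_k\Phi^{k-1}(\rho))$, where $I$ inside tensor products denotes the $2\times 2$ identity matrix. For $k\ge1$ let $$\bar x_k=I\otimes\cdots\otimes I\otimes\sigma_x\otimes I\otimes\cdots,\quad \bar y_k=I\otimes\cdots\otimes I\otimes\sigma_y\otimes I\otimes\cdots,\quad \bar z_k=I\otimes\cdots\otimes I\otimes\sigma_z\otimes I\otimes\cdots,$$ where the Pauli matrix is in the $k$-th place, and set $\bar X_n=\sum_{k=1}^n\bar x_k$, $\bar Y_n=\sum_{k=1}^n\bar y_k$, $\bar Z_n=\sum_{k=1}^n\bar z_k$, $\bar X_0=\bar Y_0=\bar Z_0=0$. $\|\nu\|=\sqrt{\nu_1^2+\nu_2^2+\nu_3^2}$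 is the Euclidean norm and $\langle\cdot,\cdot\rangle$ the corresponding inner product on $\mathbb{R}^3$. A self-adjoint element $S$ of the algebra is viewed as a real random variable whose law under $\omega$ is the probability measure $\mu_S$ on $\mathbb{R}$ determined by $\int f\,d\mu_S=\omega[f(S)]$ for bounded continuous $f$ (functional calculus). A good rate function on a Polish space $\Gamma$ is a lower semi-continuous function $\Lambda^*:\Gamma\to[0,\infty]$ with compact level sets $\{x:\Lambda^*(x)\le a\}$, $a\in[0,\infty)$. A sequence of $\Gamma$-valued random variables $(Y_n)_n$ satisfies a large deviation principle with speed $(v_n)_n$ (positive reals increasing to $\infty$) and good rate function $\Lambda^*$ if for every Borel set $B\subset\Gamma$ (with interior $B^o$ and closure $\bar B$) $$-\inf_{x\in B^o}\Lambda^*(x)\le\liminf_n\frac1{v_n}\log\mathbb{P}(Y_n\in B)\le\limsup_n\frac1{v_n}\log\mathbb{P}(Y_n\in B)\le-\inf_{x\in\bar B}\Lambda^*(x).$$ Here $\Gamma=\mathbb{R}$, the speed is $n$, and $\mathbb{P}(Y_n\in B)$ is understood as $\mu_{S_n}(B)$ for $S_n=(\nu_1\bar X_n+\nu_2\bar Y_n+\nu_3\bar Z_n)/n$.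
   Formalization: The rate function's formula is used for |x| ≤ ‖ν‖ instead of |x| < ‖ν‖, with 0·log(...) = 0 and log(a/0) = +∞ for a > 0; with +∞ at x = ±‖ν‖ as printed, I is not lower semicontinuous or is identically +∞, and the upper bound fails. *)

theory Defs
  imports
    "HOL-Analysis.Analysis"
    "HOL-Computational_Algebra.Polynomial"
    "HOL-Library.Poly_Mapping"
    "HOL-Library.Nonpos_Ints"
begin

section \<open>States and completely positive maps on 2-by-2 matrices\<close>

definition adj :: "complex^2^2 \<Rightarrow> complex^2^2" where
  "adj A = map_matrix cnj (transpose A)"

definition psd :: "complex^2^2 \<Rightarrow> bool" where
  "psd A \<longleftrightarrow> (\<forall>x::complex^2. (\<Sum>a\<in>UNIV. \<Sum>b\<in>UNIV. cnj (x $ a) * A $ a $ b * x $ b) \<in> \<real>\<^sub>\<ge>\<^sub>0)"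

definition density_matrix :: "complex^2^2 \<Rightarrow> bool" where
  "density_matrix A \<longleftrightarrow> psd A \<and> trace A = 1"

text \<open>
  A \<^term>\<open>m\<close>-by-\<^term>\<open>m\<close> array of 2-by-2 blocks is an element of the tensor product of the
  \<^term>\<open>m\<close>-by-\<^term>\<open>m\<close> matrices with the 2-by-2 matrices.  The map \<open>id \<otimes> \<Phi>\<close> acts on it blockwise.
\<close>

definition block_psd :: "nat \<Rightarrow> (nat \<Rightarrow> nat \<Rightarrow> complex^2^2) \<Rightarrow> bool" where
  "block_psd m A \<longleftrightarrow> (\<forall>x :: nat \<Rightarrow> complex^2.
     (\<Sum>i<m. \<Sum>j<m. \<Sum>a\<in>UNIV. \<Sum>b\<in>UNIV. cnj (x i $ a) * A i j $ a $ b * x j $ b) \<in> \<real>\<^sub>\<ge>\<^sub>0)"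

definition completely_positive :: "(complex^2^2 \<Rightarrow> complex^2^2) \<Rightarrow> bool" where
  "completely_positive \<Phi> \<longleftrightarrow> (\<forall>m A. block_psd m A \<longrightarrow> block_psd m (\<lambda>i j. \<Phi> (A i j)))"

definition trace_preserving :: "(complex^2^2 \<Rightarrow> complex^2^2) \<Rightarrow> bool" where
  "trace_preserving \<Phi> \<longleftrightarrow> (\<forall>A. trace (\<Phi> A) = trace A)"

definition complex_linear :: "(complex^2^2 \<Rightarrow> complex^2^2) \<Rightarrow> bool" where
  "complex_linear \<Phi> \<longleftrightarrow>
     (\<forall>A B. \<Phi> (A + B) = \<Phi> A + \<Phi> B) \<and> (\<forall>c A. \<Phi> (map_matrix ((*) c) A) = map_matrix ((*) c) (\<Phi> A))"

definition sigma_x :: "complex^2^2" where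
  "sigma_x = vector [vector [0, 1], vector [1, 0]]"

definition sigma_y :: "complex^2^2" where
  "sigma_y = vector [vector [0, - \<i>], vector [\<i>, 0]]"

definition sigma_z :: "complex^2^2" where
  "sigma_z = vector [vector [1, 0], vector [0, - 1]]"


section \<open>Complex square-summable families\<close>

typedef 'i ell2 = "{f :: 'i \<Rightarrow> complex. (\<lambda>i. (cmod (f i))\<^sup>2) summable_on UNIV}"
  morphisms coord Abs_ell2
  by (rule exI[of _ "\<lambda>_. 0"]) simp

setup_lifting type_definition_ell2

lemma summable_nonneg_le:
  fixes f g :: "'i \<Rightarrow> real"
  assumes "g summable_on A" "\<And>i. i \<in> A \<Longrightarrow> 0 \<le> f i" "\<And>i. i \<in> A \<Longrightarrow> f i \<le> g i"
  shows "f summable_on A"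
proof -
  have "(\<lambda>i. norm (g i)) summable_on A"
    using summable_on_iff_abs_summable_on_real assms(1) by blast
  then have "(\<lambda>i. norm (f i)) summable_on A"
    by (rule Infinite_Sum.abs_summable_on_comparison_test) (use assms in force)
  then show ?thesis
    by (rule Infinite_Sum.abs_summable_summable)
qed

lemma ell2_add:
  assumes "(\<lambda>i. (cmod (f i))\<^sup>2) summable_on A" "(\<lambda>i. (cmod (g i))\<^sup>2) summable_on A"
  shows "(\<lambda>i. (cmod (f i + g i))\<^sup>2) summable_on A"
proof (rule summable_nonneg_le)
  show "(\<lambda>i. 2 * (cmod (f i))\<^sup>2 + 2 * (cmod (g i))\<^sup>2) summable_on A"
    by (intro summable_on_add summable_on_cmult_right assms)
  fix i
  have "(cmod (f i + g i))\<^sup>2 \<le> (cmod (f i) + cmod (g i))\<^sup>2"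
    by (intro power_mono norm_triangle_ineq) auto
  also have "\<dots> \<le> 2 * (cmod (f i))\<^sup>2 + 2 * (cmod (g i))\<^sup>2"
    using sum_squares_bound[of "cmod (f i)" "cmod (g i)"] by (simp add: power2_sum)
  finally show "(cmod (f i + g i))\<^sup>2 \<le> 2 * (cmod (f i))\<^sup>2 + 2 * (cmod (g i))\<^sup>2" .
qed auto

lemma ell2_mult:
  assumes "(\<lambda>i. (cmod (f i))\<^sup>2) summable_on A"
  shows "(\<lambda>i. (cmod (c * f i))\<^sup>2) summable_on A"
  using summable_on_cmult_right[OF assms, of "(cmod c)\<^sup>2"]
  by (simp add: norm_mult power_mult_distrib)

lemma ell2_sum:
  assumes "finite J" "\<And>j. j \<in> J \<Longrightarrow> (\<lambda>i. (cmod (f j i))\<^sup>2) summable_on A"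
  shows "(\<lambda>i. (cmod (\<Sum>j\<in>J. f j i))\<^sup>2) summable_on A"
  using assms by (induction J rule: finite_induct) (auto intro: ell2_add)

lemma ell2_product_summable:
  assumes "(\<lambda>i. (cmod (f i))\<^sup>2) summable_on A" "(\<lambda>i. (cmod (g i))\<^sup>2) summable_on A"
  shows "(\<lambda>i. cmod (f i) * cmod (g i)) summable_on A"
proof (rule summable_nonneg_le)
  show "(\<lambda>i. (cmod (f i))\<^sup>2 + (cmod (g i))\<^sup>2) summable_on A"
    by (intro summable_on_add assms)
  fix i
  show "cmod (f i) * cmod (g i) \<le> (cmod (f i))\<^sup>2 + (cmod (g i))\<^sup>2"
    using sum_squares_bound[of "cmod (f i)" "cmod (g i)"]
      mult_nonneg_nonneg[OF norm_ge_zero[of "f i"] norm_ge_zero[of "g i"]] by linarith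
qed auto

lemma ell2_inner_summable:
  assumes "(\<lambda>i. (cmod (f i))\<^sup>2) summable_on A" "(\<lambda>i. (cmod (g i))\<^sup>2) summable_on A"
  shows "(\<lambda>i. f i \<bullet> g i) summable_on A"
proof (rule Infinite_Sum.abs_summable_summable, rule Infinite_Sum.abs_summable_on_comparison_test)
  show "(\<lambda>i. norm (cmod (f i) * cmod (g i))) summable_on A"
    using ell2_product_summable[OF assms] by simp
  show "norm (f i \<bullet> g i) \<le> norm (cmod (f i) * cmod (g i))" for i
    using Cauchy_Schwarz_ineq2[of "f i" "g i"] by simp
qed

lemma coord_summable: "(\<lambda>i. (cmod (coord \<psi> i))\<^sup>2) summable_on UNIV"
  using coord[of \<psi>] by simp

instantiation ell2 :: (type) real_vector
begin

lift_definition zero_ell2 :: "'a ell2" is "\<lambda>_. 0" by simp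
lift_definition plus_ell2 :: "'a ell2 \<Rightarrow> 'a ell2 \<Rightarrow> 'a ell2" is "\<lambda>f g i. f i + g i"
  by (rule ell2_add)
lift_definition uminus_ell2 :: "'a ell2 \<Rightarrow> 'a ell2" is "\<lambda>f i. - f i" by simp
lift_definition minus_ell2 :: "'a ell2 \<Rightarrow> 'a ell2 \<Rightarrow> 'a ell2" is "\<lambda>f g i. f i - g i"
  subgoal for f g using ell2_add[of f UNIV "\<lambda>i. - g i"] by simp
  done
lift_definition scaleR_ell2 :: "real \<Rightarrow> 'a ell2 \<Rightarrow> 'a ell2" is "\<lambda>c f i. complex_of_real c * f i"
  by (rule ell2_mult)

instance
  by standard (transfer; auto simp: fun_eq_iff algebra_simps)+

end

instantiation ell2 :: (type) real_inner
begin

definition inner_ell2 :: "'a ell2 \<Rightarrow> 'a ell2 \<Rightarrow> real" where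
  "inner_ell2 \<phi> \<psi> = (\<Sum>\<^sub>\<infinity>i. coord \<phi> i \<bullet> coord \<psi> i)"
definition norm_ell2 :: "'a ell2 \<Rightarrow> real" where
  "norm_ell2 \<psi> = sqrt (\<psi> \<bullet> \<psi>)"
definition sgn_ell2 :: "'a ell2 \<Rightarrow> 'a ell2" where
  "sgn_ell2 \<psi> = \<psi> /\<^sub>R norm \<psi>"
definition dist_ell2 :: "'a ell2 \<Rightarrow> 'a ell2 \<Rightarrow> real" where
  "dist_ell2 \<phi> \<psi> = norm (\<phi> - \<psi>)"
definition uniformity_ell2 :: "('a ell2 \<times> 'a ell2) filter" where
  "uniformity_ell2 = (INF e\<in>{0<..}. principal {(\<phi>, \<psi>). dist \<phi> \<psi> < e})"
definition open_ell2 :: "'a ell2 set \<Rightarrow> bool" where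
  "open_ell2 U = (\<forall>\<phi>\<in>U. \<forall>\<^sub>F (\<phi>', \<psi>) in uniformity. \<phi>' = \<phi> \<longrightarrow> \<psi> \<in> U)"

instance
proof
  fix x y z :: "'a ell2" and r :: real
  show "x \<bullet> y = y \<bullet> x"
    by (simp add: inner_ell2_def inner_commute)
  show "(x + y) \<bullet> z = x \<bullet> z + y \<bullet> z"
    by (simp add: inner_ell2_def plus_ell2.rep_eq inner_add_left infsum_add
        ell2_inner_summable coord_summable)
  show "(r *\<^sub>R x) \<bullet> y = r * (x \<bullet> y)"
    by (simp add: inner_ell2_def scaleR_ell2.rep_eq flip: scaleR_conv_of_real infsum_cmult_right')
  show "0 \<le> x \<bullet> x"
    by (simp add: inner_ell2_def infsum_nonneg)
  show "x \<bullet> x = 0 \<longleftrightarrow> x = 0"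
  proof
    assume *: "x \<bullet> x = 0"
    have "coord x i \<bullet> coord x i = 0" for i
      by (rule nonneg_infsum_le_0D[where A = UNIV])
        (use * in \<open>auto simp: inner_ell2_def intro!: ell2_inner_summable coord_summable\<close>)
    then show "x = 0"
      by (simp add: coord_inject[symmetric] zero_ell2.rep_eq fun_eq_iff)
  qed (simp add: inner_ell2_def zero_ell2.rep_eq)
qed (simp_all add: norm_ell2_def sgn_ell2_def dist_ell2_def uniformity_ell2_def open_ell2_def)

end

lift_definition scaleC :: "complex \<Rightarrow> 'i ell2 \<Rightarrow> 'i ell2" is "\<lambda>c f i. c * f i"
  by (rule ell2_mult)

definition cinner :: "'i ell2 \<Rightarrow> 'i ell2 \<Rightarrow> complex" where
  "cinner \<phi> \<psi> = (\<Sum>\<^sub>\<infinity>i. cnj (coord \<phi> i) * coord \<psi> i)"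

definition bounded_operators :: "('i ell2 \<Rightarrow> 'i ell2) set" where
  "bounded_operators = {T. bounded_linear T \<and> (\<forall>c \<psi>. T (scaleC c \<psi>) = scaleC c (T \<psi>))}"

definition commutant :: "('i ell2 \<Rightarrow> 'i ell2) set \<Rightarrow> ('i ell2 \<Rightarrow> 'i ell2) set" where
  "commutant \<A> = {T \<in> bounded_operators. \<forall>S\<in>\<A>. T \<circ> S = S \<circ> T}"


section \<open>Functional calculus and laws of observables\<close>

definition poly_op :: "real poly \<Rightarrow> ('h::real_normed_vector \<Rightarrow> 'h) \<Rightarrow> 'h \<Rightarrow> 'h" where
  "poly_op p S \<psi> = (\<Sum>i\<le>degree p. coeff p i *\<^sub>R (S ^^ i) \<psi>)"

text \<open>
  For self-adjoint \<open>S\<close> in the von Neumann algebra \<open>\<M>\<close> and continuous \<open>f\<close>, the operator \<open>f(S)\<close> is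
  the limit in operator norm of \<open>p\<^sub>m(S)\<close>, for polynomials \<open>p\<^sub>m\<close> converging to \<open>f\<close> uniformly on the
  interval from \<open>-\<parallel>S\<parallel>\<close> to \<open>\<parallel>S\<parallel>\<close>, which contains the spectrum of \<open>S\<close>.
\<close>

definition fun_calc ::
  "('h::real_normed_vector \<Rightarrow> 'h) set \<Rightarrow> (real \<Rightarrow> real) \<Rightarrow> ('h \<Rightarrow> 'h) \<Rightarrow> ('h \<Rightarrow> 'h)" where
  "fun_calc \<M> f S = (THE T. T \<in> \<M> \<and> (\<exists>p :: nat \<Rightarrow> real poly.
     uniform_limit {- onorm S..onorm S} (\<lambda>m. poly (p m)) f sequentially \<and>
     (\<lambda>m. onorm (\<lambda>\<psi>. poly_op (p m) S \<psi> - T \<psi>)) \<longlonglongrightarrow> 0))"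

definition law ::
  "('h::real_normed_vector \<Rightarrow> 'h) set \<Rightarrow> (('h \<Rightarrow> 'h) \<Rightarrow> complex) \<Rightarrow> ('h \<Rightarrow> 'h) \<Rightarrow> real measure" where
  "law \<M> \<omega> S = (THE \<mu>. sets \<mu> = sets borel \<and> emeasure \<mu> (space \<mu>) = 1 \<and>
     (\<forall>f. continuous_on UNIV f \<and> bounded (range f) \<longrightarrow>
        complex_of_real (\<integral>x. f x \<partial>\<mu>) = \<omega> (fun_calc \<M> f S)))"


section \<open>The infinite tensor product with respect to a product state\<close>

text \<open>
  For a density matrix \<open>\<rho>\<close> choose \<open>W\<close> with \<open>W W\<^sup>* = \<rho>\<close>, so that \<open>\<langle>W, A W\<rangle> = Trace(A \<rho>)\<close> for the
  inner product \<open>\<langle>X, Y\<rangle> = Trace(X\<^sup>* Y)\<close>.  The 2-by-2 matrices act by left multiplication on this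
  four-dimensional Hilbert space.  The site basis is an orthonormal basis of it whose zeroth element
  is such a \<open>W\<close>.  Different choices give unitarily equivalent representations with the same state.
\<close>

definition site_basis :: "complex^2^2 \<Rightarrow> 4 \<Rightarrow> complex^2^2" where
  "site_basis \<rho> = (SOME B. B 0 ** adj (B 0) = \<rho> \<and>
     (\<forall>i j. trace (adj (B i) ** B j) = (if i = j then 1 else 0)))"

definition site_coeff :: "complex^2^2 \<Rightarrow> complex^2^2 \<Rightarrow> 4 \<Rightarrow> 4 \<Rightarrow> complex" where
  "site_coeff \<rho> A i j = trace (adj (site_basis \<rho> i) ** A ** site_basis \<rho> j)"

text \<open>
  Von Neumann's incomplete tensor product of the site spaces along the vectors \<open>W\<close> has an
  orthonormal basis indexed by the configurations in which all but finitely many sites are in the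
  zeroth basis element.  The site operator with index \<open>k\<close> is \<open>I \<otimes> \<dots> \<otimes> I \<otimes> A \<otimes> I \<otimes> \<dots>\<close>, where \<open>A\<close>
  is in the factor carrying the state \<open>r k\<close>; factors are numbered from 0.
\<close>

lemma ell2_update_summable:
  fixes f :: "(nat \<Rightarrow>\<^sub>0 4) \<Rightarrow> complex"
  assumes "(\<lambda>s. (cmod (f s))\<^sup>2) summable_on UNIV"
  shows "(\<lambda>s. (cmod (f (Poly_Mapping.update k j s)))\<^sup>2) summable_on UNIV"
proof -
  let ?u = "Poly_Mapping.update k j"
  let ?S = "\<lambda>i. {s :: nat \<Rightarrow>\<^sub>0 4. Poly_Mapping.lookup s k = i}"
  have "(\<lambda>s. (cmod (f (?u s)))\<^sup>2) summable_on ?S i" for i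
  proof -
    have inj: "inj_on ?u (?S i)"
    proof (rule inj_onI)
      fix s t assume st: "s \<in> ?S i" "t \<in> ?S i" "?u s = ?u t"
      show "s = t"
      proof (rule poly_mapping_eqI)
        fix l
        have "Poly_Mapping.lookup (?u s) l = Poly_Mapping.lookup (?u t) l"
          using st(3) by simp
        then show "Poly_Mapping.lookup s l = Poly_Mapping.lookup t l"
          using st(1,2) by (cases "l = k") (auto simp: lookup_update split: if_splits)
      qed
    qed
    have "(\<lambda>s. (cmod (f s))\<^sup>2) summable_on (?u ` ?S i)"
      by (rule summable_on_subset_banach[OF assms]) simp
    then show ?thesis
      by (simp add: summable_on_reindex[OF inj] o_def)
  qed
  then have "(\<lambda>s. (cmod (f (?u s)))\<^sup>2) summable_on (\<Union>i\<in>UNIV. ?S i)"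
    by (intro summable_on_finite_union_disjoint) auto
  moreover have "(\<Union>i\<in>UNIV. ?S i) = UNIV"
    by auto
  ultimately show ?thesis
    by simp
qed

lift_definition site_op ::
  "(nat \<Rightarrow> complex^2^2) \<Rightarrow> nat \<Rightarrow> complex^2^2 \<Rightarrow> (nat \<Rightarrow>\<^sub>0 4) ell2 \<Rightarrow> (nat \<Rightarrow>\<^sub>0 4) ell2" is
  "\<lambda>r k A \<psi> s. \<Sum>j\<in>UNIV.
     site_coeff (r k) A (Poly_Mapping.lookup s k) j * \<psi> (Poly_Mapping.update k j s)"
proof (rule ell2_sum)
  fix r :: "nat \<Rightarrow> complex^2^2" and k A and \<psi> :: "(nat \<Rightarrow>\<^sub>0 4) \<Rightarrow> complex" and j :: 4
  assume \<psi>: "(\<lambda>s. (cmod (\<psi> s))\<^sup>2) summable_on UNIV"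
  define C where "C = (\<Sum>i\<in>UNIV. cmod (site_coeff (r k) A i j))"
  show "(\<lambda>s. (cmod (site_coeff (r k) A (Poly_Mapping.lookup s k) j
      * \<psi> (Poly_Mapping.update k j s)))\<^sup>2) summable_on UNIV"
  proof (rule summable_nonneg_le)
    show "(\<lambda>s. C\<^sup>2 * (cmod (\<psi> (Poly_Mapping.update k j s)))\<^sup>2) summable_on UNIV"
      by (intro summable_on_cmult_right ell2_update_summable \<psi>)
    fix s
    have "cmod (site_coeff (r k) A (Poly_Mapping.lookup s k) j) \<le> C"
      unfolding C_def by (intro member_le_sum) auto
    then show "(cmod (site_coeff (r k) A (Poly_Mapping.lookup s k) j
        * \<psi> (Poly_Mapping.update k j s)))\<^sup>2 \<le> C\<^sup>2 * (cmod (\<psi> (Poly_Mapping.update k j s)))\<^sup>2"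
      by (simp add: norm_mult power_mult_distrib mult_right_mono power_mono)
  qed auto
qed auto

definition tensor_algebra ::
  "(nat \<Rightarrow> complex^2^2) \<Rightarrow> ((nat \<Rightarrow>\<^sub>0 4) ell2 \<Rightarrow> (nat \<Rightarrow>\<^sub>0 4) ell2) set" where
  "tensor_algebra r = commutant (commutant {site_op r k A | k A. True})"

definition vacuum :: "(nat \<Rightarrow>\<^sub>0 4) ell2" where
  "vacuum = Abs_ell2 (\<lambda>s. if s = 0 then 1 else 0)"

lemma coord_vacuum: "coord vacuum s = (if s = 0 then 1 else 0)"
proof -
  have "(\<lambda>s :: nat \<Rightarrow>\<^sub>0 4. (cmod (if s = 0 then 1 else 0))\<^sup>2) summable_on UNIV
      \<longleftrightarrow> (\<lambda>s :: nat \<Rightarrow>\<^sub>0 4. (cmod (if s = 0 then 1 else 0))\<^sup>2) summable_on {0}"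
    by (rule summable_on_cong_neutral) auto
  then show ?thesis
    unfolding vacuum_def by (subst Abs_ell2_inverse) auto
qed

text \<open>
  The product state does not mention \<open>r\<close>: the dependence on the factor states is in \<^const>\<open>site_op\<close>.
\<close>

definition product_state :: "((nat \<Rightarrow>\<^sub>0 4) ell2 \<Rightarrow> (nat \<Rightarrow>\<^sub>0 4) ell2) \<Rightarrow> complex" where
  "product_state T = cinner vacuum (T vacuum)"

definition partial_sum ::
  "(nat \<Rightarrow> complex^2^2) \<Rightarrow> complex^2^2 \<Rightarrow> nat \<Rightarrow> (nat \<Rightarrow>\<^sub>0 4) ell2 \<Rightarrow> (nat \<Rightarrow>\<^sub>0 4) ell2" where
  "partial_sum r A n \<psi> = (\<Sum>k<n. site_op r k A \<psi>)"

abbreviation "X_bar r \<equiv> partial_sum r sigma_x"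
abbreviation "Y_bar r \<equiv> partial_sum r sigma_y"
abbreviation "Z_bar r \<equiv> partial_sum r sigma_z"

definition spin_mean ::
  "(nat \<Rightarrow> complex^2^2) \<Rightarrow> real^3 \<Rightarrow> nat \<Rightarrow> (nat \<Rightarrow>\<^sub>0 4) ell2 \<Rightarrow> (nat \<Rightarrow>\<^sub>0 4) ell2" where
  "spin_mean r \<nu> n \<psi> =
     (1 / real n) *\<^sub>R (\<nu>$1 *\<^sub>R X_bar r n \<psi> + \<nu>$2 *\<^sub>R Y_bar r n \<psi> + \<nu>$3 *\<^sub>R Z_bar r n \<psi>)"


section \<open>Large deviations\<close>

definition eln :: "ereal \<Rightarrow> ereal" where
  "eln x = (if x \<le> 0 then - \<infinity> else if x = \<infinity> then \<infinity> else ereal (ln (real_of_ereal x)))"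

definition good_rate_function :: "('a::polish_space \<Rightarrow> ereal) \<Rightarrow> bool" where
  "good_rate_function I \<longleftrightarrow>
     (\<forall>x. 0 \<le> I x) \<and>
     (\<forall>x. I x \<le> Liminf (at x) I) \<and>
     (\<forall>a\<ge>0. compact {x. I x \<le> ereal a})"

text \<open>Only the indices \<open>n \<ge> 1\<close> matter.\<close>

definition large_deviation_principle ::
  "(nat \<Rightarrow> 'a::polish_space measure) \<Rightarrow> (nat \<Rightarrow> real) \<Rightarrow> ('a \<Rightarrow> ereal) \<Rightarrow> bool" where
  "large_deviation_principle \<mu> v I \<longleftrightarrow>
     (\<forall>n\<ge>1. 0 < v n) \<and> mono_on {1..} v \<and> filterlim v at_top sequentially \<and>
     good_rate_function I \<and>
     (\<forall>B\<in>sets borel.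
        - (INF x\<in>interior B. I x) \<le> liminf (\<lambda>n. ereal (1 / v n) * eln (ereal (measure (\<mu> n) B))) \<and>
        limsup (\<lambda>n. ereal (1 / v n) * eln (ereal (measure (\<mu> n) B))) \<le> - (INF x\<in>closure B. I x))"

text \<open>
  The relative-entropy formula is evaluated in the extended reals, where \<open>log 0 = -\<infinity>\<close>, \<open>a/0 = \<infinity>\<close> for \<open>a > 0\<close>,
  \<open>0/0 = 0\<close>, \<open>log \<infinity> = \<infinity>\<close> and \<open>0 \<cdot> (\<plusminus>\<infinity>) = 0\<close>.  The endpoints \<open>x = \<plusminus>\<parallel>\<nu>\<parallel>\<close> belong to the
  first case: with the value \<open>\<infinity>\<close> there the function would not be lower semicontinuous when
  \<open>\<bar>\<langle>\<nu>, v\<rangle>\<bar> < \<parallel>\<nu>\<parallel>\<close>, and it would be identically \<open>\<infinity>\<close> when \<open>\<bar>\<langle>\<nu>, v\<rangle>\<bar> = \<parallel>\<nu>\<parallel>\<close>.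
\<close>

definition spin_rate :: "real^3 \<Rightarrow> real^3 \<Rightarrow> real \<Rightarrow> ereal" where
  "spin_rate \<nu> v x =
     (if \<bar>x\<bar> \<le> norm \<nu> then
        ereal (1/2) *
          (ereal (1 + x / norm \<nu>) * eln (ereal (norm \<nu> + x) / ereal (norm \<nu> + \<nu> \<bullet> v)) +
           ereal (1 - x / norm \<nu>) * eln (ereal (norm \<nu> - x) / ereal (norm \<nu> - \<nu> \<bullet> v)))
      else \<infinity>)"

end

theory Submission
  imports Defs "HOL-Probability.Probability" "HOL-Real_Asymp.Real_Asymp"
begin

text \<open>
  The observable \<open>S\<^sub>n = (\<nu>\<^sub>1 X\<^sub>n + \<nu>\<^sub>2 Y\<^sub>n + \<nu>\<^sub>3 Z\<^sub>n) / n\<close> is a mean of commuting copies of a matrix with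
  eigenvalues \<open>\<plusminus>\<parallel>\<nu>\<parallel>\<close>.  The products of the one-site spectral projections form a finite resolution of
  the identity that diagonalizes \<open>S\<^sub>n\<close>, and the product state makes the sites independent, so the law of
  \<open>S\<^sub>n\<close> is that of a mean of independent \<open>\<plusminus>\<parallel>\<nu>\<parallel>\<close>-valued variables.  The probabilities \<open>p\<^sub>k\<close> of the value
  \<open>+\<parallel>\<nu>\<parallel>\<close> converge to \<open>(1 + \<langle>\<nu>, v\<rangle>/\<parallel>\<nu>\<parallel>)/2\<close>, so the normalized cumulant generating functions converge to
  the one of the limiting two-point law, whose convex conjugate is the rate function.  The upper
  bound is Chernoff's inequality with a finite cover of a compact set; the lower bound is obtained by
  exponential tilting, where the law of large numbers for the tilted variables is itself a
  consequence of the upper bound.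
\<close>

section \<open>Independent two-valued variables\<close>

text \<open>The scheme is that of Gartner and Ellis, run on finite sums over the sets
  \<open>U\<close> of sites with value \<open>+R\<close>. The site parameters are only known to
  converge; they may equal 0 or 1, and so may their limit \<open>q\<close>. If \<open>q\<close> is 0
  or 1, the cumulant generating function is linear and the rate is 0 at one end of the interval and
  infinite elsewhere, so these cases are split off wherever the rate is evaluated. If
  \<open>0 < q < 1\<close>, the obstacle is at the ends \<open>R\<close> and \<open>-R\<close>: the
  rate is finite there, but the supremum in the conjugate is only approached as the tilt parameter
  tends to infinity, and no tilted law has its mean there. Hence duality is phrased with strict
  lower bounds \<open>c\<close>, and in the lower bound an end point is replaced by nearby tilted
  means of no greater cost. On the operator side, \<open>fun_calc\<close> and \<open>law\<close> are
  definite descriptions, so each value needs both existence and uniqueness.\<close>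

definition bern :: "(nat \<Rightarrow> real) \<Rightarrow> nat \<Rightarrow> nat set \<Rightarrow> real" where
  "bern p n U = (\<Prod>k\<in>U. p k) * (\<Prod>k\<in>{..<n} - U. 1 - p k)"

definition spin_val :: "real \<Rightarrow> nat \<Rightarrow> nat set \<Rightarrow> real" where
  "spin_val R n U = R * (2 * real (card U) - real n) / real n"

definition bern_prob :: "real \<Rightarrow> (nat \<Rightarrow> real) \<Rightarrow> nat \<Rightarrow> real set \<Rightarrow> real" where
  "bern_prob R p n B = (\<Sum>U | U \<subseteq> {..<n} \<and> spin_val R n U \<in> B. bern p n U)"

definition mgf :: "real \<Rightarrow> real \<Rightarrow> real \<Rightarrow> real" where
  "mgf R p t = p * exp (t * R) + (1 - p) * exp (- (t * R))"

text \<open>The Esscher transform of a two-point law: a value \<open>z\<close> is reweighted by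
  \<open>exp (t * z)\<close> and \<open>mgf R p t\<close> normalizes. The parameters 0 and 1 are
  fixed points, so deterministic sites stay deterministic.\<close>

definition tilt :: "real \<Rightarrow> real \<Rightarrow> real \<Rightarrow> real" where
  "tilt R t p = p * exp (t * R) / mgf R p t"

lemma mgf_pos: "0 \<le> p \<Longrightarrow> p \<le> 1 \<Longrightarrow> 0 < mgf R p t"
  unfolding mgf_def by (cases "p = 0") (auto intro!: add_pos_nonneg)

lemma mgf_0 [simp]: "mgf R p 0 = 1"
  by (simp add: mgf_def)

lemma one_minus_tilt:
  "0 \<le> p \<Longrightarrow> p \<le> 1 \<Longrightarrow> 1 - tilt R t p = (1 - p) * exp (- (t * R)) / mgf R p t"
  using mgf_pos[of p R t] by (simp add: tilt_def divide_simps) (simp add: mgf_def algebra_simps)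

lemma tilt_bounds: "0 \<le> p \<Longrightarrow> p \<le> 1 \<Longrightarrow> 0 \<le> tilt R t p \<and> tilt R t p \<le> 1"
  using mgf_pos[of p R t] one_minus_tilt[of p R t] by (auto simp: tilt_def field_simps mgf_def)

lemma range_unit_interval: "range p \<subseteq> {0..1::real} \<Longrightarrow> 0 \<le> p k \<and> p k \<le> 1"
  by (auto simp: image_subset_iff)

lemma bern_nonneg: "range p \<subseteq> {0..1} \<Longrightarrow> 0 \<le> bern p n U"
  unfolding bern_def by (intro mult_nonneg_nonneg prod_nonneg) (auto dest: range_unit_interval)

lemma limit_unit_interval: "range p \<subseteq> {0..1::real} \<Longrightarrow> p \<longlonglongrightarrow> q \<Longrightarrow> 0 \<le> q \<and> q \<le> 1"
  using range_unit_interval[of p] by (auto intro: LIMSEQ_le_const LIMSEQ_le_const2)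

lemma mgf_sequence_pos: "range p \<subseteq> {0..1} \<Longrightarrow> 0 < mgf R (p k) t"
  using range_unit_interval[of p k] mgf_pos by blast

lemma sum_bern: "(\<Sum>U\<in>Pow {..<n}. bern p n U) = 1"
  using prod_add[of "{..<n}" p "\<lambda>k. 1 - p k"] by (simp add: bern_def)

text \<open>This is the density of the tilted law, multiplied out. The site factors
  \<open>exp (t * R)\<close> on \<open>U\<close> and \<open>exp (- (t * R))\<close> off
  \<open>U\<close> combine to the exponent \<open>t * R * (2 * card U - n)\<close>, which is
  \<open>n * t\<close> times the mean; \<open>n > 0\<close> cancels the division in
  \<open>spin_val\<close>.\<close>

lemma bern_tilt:
  assumes p: "range p \<subseteq> {0..1}" and U: "U \<subseteq> {..<n}" and n: "n > 0"
  shows "bern (\<lambda>k. tilt R t (p k)) n U * (\<Prod>k<n. mgf R (p k) t)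
    = bern p n U * exp (real n * (t * spin_val R n U))"
proof -
  have fU: "finite U" using U finite_subset by blast
  have cU: "card U \<le> n" using U card_mono[of "{..<n}" U] by simp
  have split: "(\<Prod>k<n. mgf R (p k) t) = (\<Prod>k\<in>U. mgf R (p k) t) * (\<Prod>k\<in>{..<n}-U. mgf R (p k) t)"
    using U by (metis finite_lessThan mult.commute prod.subset_diff)
  have 1: "(\<Prod>k\<in>U. tilt R t (p k)) * (\<Prod>k\<in>U. mgf R (p k) t) = (\<Prod>k\<in>U. p k) * exp (t * R) ^ card U"
  proof -
    have "(\<Prod>k\<in>U. tilt R t (p k)) * (\<Prod>k\<in>U. mgf R (p k) t) = (\<Prod>k\<in>U. p k * exp (t * R))"
      unfolding prod.distrib[symmetric]
      by (rule prod.cong) (use range_unit_interval[OF p] mgf_sequence_pos[OF p, of R _ t] in \<open>simp_all add: tilt_def less_imp_neq[THEN not_sym]\<close>)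
    then show ?thesis by (simp add: prod.distrib)
  qed
  have 2: "(\<Prod>k\<in>{..<n}-U. 1 - tilt R t (p k)) * (\<Prod>k\<in>{..<n}-U. mgf R (p k) t)
      = (\<Prod>k\<in>{..<n}-U. 1 - p k) * exp (- (t * R)) ^ card ({..<n}-U)"
  proof -
    have "(\<Prod>k\<in>{..<n}-U. 1 - tilt R t (p k)) * (\<Prod>k\<in>{..<n}-U. mgf R (p k) t)
        = (\<Prod>k\<in>{..<n}-U. (1 - p k) * exp (- (t * R)))"
      unfolding prod.distrib[symmetric]
      by (rule prod.cong) (use range_unit_interval[OF p] mgf_sequence_pos[OF p, of R _ t] in \<open>simp_all add: one_minus_tilt less_imp_neq[THEN not_sym]\<close>)
    then show ?thesis by (simp add: prod.distrib)
  qed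
  have card: "card ({..<n} - U) = n - card U"
    using U fU by (simp add: card_Diff_subset)
  have "real (card U) * (t * R) + (real n - real (card U)) * - (t * R) = real n * (t * spin_val R n U)"
    using n by (simp add: spin_val_def) (simp add: algebra_simps)
  then have 3: "exp (t * R) ^ card U * exp (- (t * R)) ^ (n - card U) = exp (real n * (t * spin_val R n U))"
    using cU by (simp flip: exp_of_nat_mult exp_add add: of_nat_diff)
  show ?thesis
    using arg_cong2[OF 1 2, of "(*)"] unfolding bern_def split 3[symmetric] card by (simp only: ac_simps)
qed

text \<open>The tilted weights again sum to 1, so summing \<open>bern_tilt\<close> leaves only the
  normalizing factors.\<close>

lemma bern_mgf:
  assumes p: "range p \<subseteq> {0..1}" and n: "n > 0"
  shows "(\<Sum>U\<in>Pow {..<n}. bern p n U * exp (real n * (t * spin_val R n U))) = (\<Prod>k<n. mgf R (p k) t)"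
proof -
  have "(\<Sum>U\<in>Pow {..<n}. bern p n U * exp (real n * (t * spin_val R n U)))
     = (\<Sum>U\<in>Pow {..<n}. bern (\<lambda>k. tilt R t (p k)) n U * (\<Prod>k<n. mgf R (p k) t))"
    by (rule sum.cong) (use bern_tilt[OF p _ n] in auto)
  then show ?thesis by (simp add: sum_bern flip: sum_distrib_right)
qed

lemma prod_mgf_eq_exp:
  assumes p: "range p \<subseteq> {0..1}"
  shows "(\<Prod>k<n::nat. mgf R (p k) t) = exp (\<Sum>k<n. ln (mgf R (p k) t))"
  by (induction n) (simp_all add: exp_add mgf_sequence_pos[OF p])

lemma finite_spin_set [simp]: "finite {U. U \<subseteq> {..<n::nat} \<and> P U}"
  by (rule finite_subset[of _ "Pow {..<n}"]) auto

lemma bern_prob_nonneg: "range p \<subseteq> {0..1} \<Longrightarrow> 0 \<le> bern_prob R p n B"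
  unfolding bern_prob_def by (intro sum_nonneg bern_nonneg) auto

lemma bern_prob_mono:
  assumes "range p \<subseteq> {0..1}" "B \<subseteq> C"
  shows "bern_prob R p n B \<le> bern_prob R p n C"
  unfolding bern_prob_def by (rule sum_mono2) (use assms bern_nonneg in auto)

lemma bern_prob_Un:
  assumes "range p \<subseteq> {0..1}"
  shows "bern_prob R p n (B \<union> C) \<le> bern_prob R p n B + bern_prob R p n C"
proof -
  have "{U. U \<subseteq> {..<n} \<and> spin_val R n U \<in> B \<union> C}
      = {U. U \<subseteq> {..<n} \<and> spin_val R n U \<in> B} \<union> {U. U \<subseteq> {..<n} \<and> spin_val R n U \<in> C}" by auto
  then show ?thesis unfolding bern_prob_def
    by (simp only: sum_Un finite_spin_set) (simp add: sum_nonneg bern_nonneg[OF assms])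
qed

lemma bern_prob_Compl: "bern_prob R p n (- B) = 1 - bern_prob R p n B"
proof -
  have "Pow {..<n} = {U. U \<subseteq> {..<n} \<and> spin_val R n U \<in> B} \<union> {U. U \<subseteq> {..<n} \<and> spin_val R n U \<in> - B}" by auto
  then have "1 = bern_prob R p n B + bern_prob R p n (- B)" unfolding bern_prob_def
    by (subst sum_bern[of p n, symmetric]) (simp only:, subst sum.union_disjoint, auto)
  then show ?thesis by simp
qed

lemma bern_prob_UN:
  assumes "range p \<subseteq> {0..1}" "finite F"
  shows "bern_prob R p n (\<Union>i\<in>F. B i) \<le> (\<Sum>i\<in>F. bern_prob R p n (B i))"
  using assms(2)
proof (induction F rule: finite_induct)
  case empty
  then show ?case by (simp add: bern_prob_def)
next
  case (insert i F)
  then show ?case using bern_prob_Un[OF assms(1), of R n "B i" "\<Union>i\<in>F. B i"] by simp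
qed

section \<open>Exponential upper bounds on compact sets\<close>

lemma spin_val_bounds:
  assumes "0 \<le> R" "U \<subseteq> {..<n}" "n > 0"
  shows "spin_val R n U \<in> {-R..R}"
proof -
  have "card U \<le> n" using assms card_mono[of "{..<n}" U] by simp
  then show ?thesis using assms mult_left_mono[of "real (card U)" "real n" R]
    by (auto simp: spin_val_def field_simps)
qed

text \<open>Every mean lies in \<open>{-R..R}\<close>, so a closed set can be exchanged for a
  compact one; this takes the place of exponential tightness.\<close>

lemma bern_prob_restrict:
  assumes "0 \<le> R" "n > 0"
  shows "bern_prob R p n (B \<inter> {-R..R}) = bern_prob R p n B"
  unfolding bern_prob_def by (rule sum.cong) (use spin_val_bounds[OF assms(1) _ assms(2)] in auto)

text \<open>Exponential Markov inequality: the factor \<open>exp (n * (t * z - a))\<close> is at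
  least 1 on \<open>B\<close>, and once it is inserted the sum can be extended to all
  configurations. The sign of \<open>t\<close> is free, so half-lines in both directions are
  covered.\<close>

lemma chernoff:
  assumes p: "range p \<subseteq> {0..1}" and n: "n > 0" and a: "\<And>z. z \<in> B \<Longrightarrow> a \<le> t * z"
  shows "bern_prob R p n B \<le> exp (- (real n * a) + (\<Sum>k<n. ln (mgf R (p k) t)))"
proof -
  have "bern_prob R p n B \<le> (\<Sum>U | U \<subseteq> {..<n} \<and> spin_val R n U \<in> B.
      bern p n U * exp (real n * (t * spin_val R n U)) * exp (- (real n * a)))"
    unfolding bern_prob_def
  proof (rule sum_mono, clarsimp)
    fix U assume "spin_val R n U \<in> B"
    then have "real n * a \<le> real n * (t * spin_val R n U)"
      using a by (simp add: mult_left_mono)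
    then have "1 \<le> exp (real n * (t * spin_val R n U)) * exp (- (real n * a))"
      by (simp flip: exp_add)
    from mult_left_mono[OF this bern_nonneg[OF p, of n U]]
    show "bern p n U \<le> bern p n U * exp (real n * (t * spin_val R n U)) * exp (- (real n * a))"
      by (simp add: mult.assoc)
  qed
  also have "\<dots> \<le> (\<Sum>U\<in>Pow {..<n}. bern p n U * exp (real n * (t * spin_val R n U)) * exp (- (real n * a)))"
    by (rule sum_mono2) (use bern_nonneg[of p n] p in auto)
  also have "\<dots> = exp (- (real n * a) + (\<Sum>k<n. ln (mgf R (p k) t)))"
    using bern_mgf[OF p n, of t R] prod_mgf_eq_exp[OF p, where R = R and t = t and n = n]
    by (simp add: exp_diff exp_minus divide_inverse flip: sum_distrib_right)
  finally show ?thesis .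
qed

lemma cesaro_mean_tendsto:
  fixes a :: "nat \<Rightarrow> real"
  assumes "a \<longlonglongrightarrow> l"
  shows "(\<lambda>n. (\<Sum>k<n. a k) / real n) \<longlonglongrightarrow> l"
proof (rule LIMSEQ_I)
  fix e :: real assume e: "e > 0"
  obtain N where N: "\<And>k. k \<ge> N \<Longrightarrow> \<bar>a k - l\<bar> < e / 2"
    using LIMSEQ_D[OF assms, of "e/2"] e by auto
  define C where "C = (\<Sum>k<N. \<bar>a k - l\<bar>)"
  obtain M :: nat where M: "real M > 2 * C / e" using reals_Archimedean2 by blast
  show "\<exists>no. \<forall>n\<ge>no. norm ((\<Sum>k<n. a k) / real n - l) < e"
  proof (intro exI allI impI)
    fix n assume n: "max (N + 1) (M + 1) \<le> n"
    have "(\<Sum>k<n. a k) / real n - l = (\<Sum>k<n. a k - l) / real n"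
      using n by (simp add: sum_subtractf field_simps)
    moreover have "\<bar>\<Sum>k<n. a k - l\<bar> \<le> C + real n * (e / 2)"
    proof -
      have "\<bar>\<Sum>k<n. a k - l\<bar> \<le> (\<Sum>k<n. \<bar>a k - l\<bar>)" by (rule sum_abs)
      also have "\<dots> = C + (\<Sum>k=N..<n. \<bar>a k - l\<bar>)"
        unfolding C_def using n by (simp add: lessThan_atLeast0 sum.atLeastLessThan_concat)
      also have "(\<Sum>k=N..<n. \<bar>a k - l\<bar>) \<le> (\<Sum>k=N..<n. e / 2)"
        by (rule sum_mono) (use N less_imp_le in auto)
      also have "\<dots> \<le> real n * (e / 2)" using e by simp
      finally show ?thesis by simp
    qed
    moreover have "C < real n * (e / 2)"
    proof -
      have "2 * C / e < real n" using M n by simp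
      then show ?thesis using e by (simp add: field_simps)
    qed
    ultimately show "norm ((\<Sum>k<n. a k) / real n - l) < e"
      using n by (simp add: field_simps)
  qed
qed

text \<open>The sites are not identically distributed, so the normalized logarithm is a Cesaro mean
  of site values. The logarithm is continuous at the limit because \<open>mgf R q t\<close> is
  positive on all of \<open>0 \<le> q \<le> 1\<close>, end points included.\<close>

lemma ln_mgf_tendsto:
  assumes p: "range p \<subseteq> {0..1}" and q: "p \<longlonglongrightarrow> q"
  shows "(\<lambda>n. (\<Sum>k<n. ln (mgf R (p k) t)) / real n) \<longlonglongrightarrow> ln (mgf R q t)"
proof (rule cesaro_mean_tendsto)
  have "mgf R q t \<noteq> 0" using mgf_pos[of q R t] limit_unit_interval[OF p q] by simp
  then show "(\<lambda>k. ln (mgf R (p k) t)) \<longlonglongrightarrow> ln (mgf R q t)"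
    unfolding mgf_def by (intro tendsto_ln tendsto_add tendsto_mult tendsto_diff q tendsto_const)
qed

lemma bern_prob_local_upper:
  assumes p: "range p \<subseteq> {0..1}" and q: "p \<longlonglongrightarrow> q"
    and c: "c < t * x - ln (mgf R q t)"
  shows "\<exists>V c'. open V \<and> x \<in> V \<and> c < c' \<and> (\<forall>\<^sub>F n in sequentially. bern_prob R p n V \<le> exp (- (real n * c')))"
proof -
  \<comment> \<open>The gap is divided into four: one \<open>d\<close> pays for the neighbourhood
    \<open>V\<close>, one for the Cesaro error, one lifts the exponent strictly above
    \<open>c\<close>, and one is left over.\<close>
  define d where "d = (t * x - ln (mgf R q t) - c) / 4"
  have d: "d > 0" using c by (simp add: d_def)
  define V where "V = {z. t * x - d < t * z}"
  have "open V" unfolding V_def by (intro open_Collect_less continuous_intros)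
  moreover have "x \<in> V" using d by (simp add: V_def)
  moreover have "c < c + d" using d by simp
  moreover have "\<forall>\<^sub>F n in sequentially. bern_prob R p n V \<le> exp (- (real n * (c + d)))"
  proof -
    have "\<forall>\<^sub>F n in sequentially. (\<Sum>k<n. ln (mgf R (p k) t)) / real n < ln (mgf R q t) + d"
      using order_tendstoD(2)[OF ln_mgf_tendsto[OF p q]] d by simp
    with eventually_gt_at_top[of 0] show ?thesis
    proof eventually_elim
      case (elim n)
      have "bern_prob R p n V \<le> exp (- (real n * (t * x - d)) + (\<Sum>k<n. ln (mgf R (p k) t)))"
        by (rule chernoff[OF p elim(1)]) (auto simp: V_def)
      also have "\<dots> \<le> exp (- (real n * (c + d)))"
      proof -
        have "(\<Sum>k<n. ln (mgf R (p k) t)) \<le> real n * (ln (mgf R q t) + d)"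
          using elim by (simp add: field_simps)
        also have "ln (mgf R q t) + d = (t * x - d) - (c + d) - d"
          unfolding d_def by (simp add: field_simps)
        also have "real n * \<dots> \<le> real n * ((t * x - d) - (c + d))"
          using d by (intro mult_left_mono) auto
        finally show ?thesis by (simp add: algebra_simps)
      qed
      finally show ?case .
    qed
  qed
  ultimately show ?thesis by blast
qed

text \<open>Finitely many of the local neighbourhoods cover \<open>K\<close>, and the least of their
  finitely many exponents is still strictly above \<open>c\<close>. The strict gap later absorbs the
  constant \<open>C\<close>.\<close>

lemma bern_prob_compact_upper:
  assumes p: "range p \<subseteq> {0..1}" and q: "p \<longlonglongrightarrow> q" and "compact K"
    and c: "\<And>x. x \<in> K \<Longrightarrow> \<exists>t. c < t * x - ln (mgf R q t)"
  shows "\<exists>C>0. \<exists>c'>c. \<forall>\<^sub>F n in sequentially. bern_prob R p n K \<le> C * exp (- (real n * c'))"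
proof -
  have "\<forall>x\<in>K. \<exists>V c'. open V \<and> x \<in> V \<and> c < c' \<and>
      (\<forall>\<^sub>F n in sequentially. bern_prob R p n V \<le> exp (- (real n * c')))"
    using c bern_prob_local_upper[OF p q] by blast
  then obtain V c' where V: "\<And>x. x \<in> K \<Longrightarrow> open (V x) \<and> x \<in> V x \<and> c < c' x \<and>
      (\<forall>\<^sub>F n in sequentially. bern_prob R p n (V x) \<le> exp (- (real n * c' x)))"
    by metis
  obtain F where F: "F \<subseteq> K" "finite F" "K \<subseteq> (\<Union>x\<in>F. V x)"
    using compactE_image[OF \<open>compact K\<close>, of K V] V by blast
  \<comment> \<open>The extra element \<open>c + 1\<close> keeps the set non-empty when the cover
    \<open>F\<close> is empty; likewise the summand 1 added to \<open>card F\<close> below keeps the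
    constant positive.\<close>
  define d where "d = Min (insert (c + 1) (c' ` F))"
  have d: "c < d" "\<And>x. x \<in> F \<Longrightarrow> d \<le> c' x"
    using F V by (auto simp: d_def)
  have "\<forall>\<^sub>F n in sequentially. \<forall>x\<in>F. bern_prob R p n (V x) \<le> exp (- (real n * c' x))"
    using F V by (intro eventually_ball_finite) auto
  then have "\<forall>\<^sub>F n in sequentially. bern_prob R p n K \<le> (real (card F) + 1) * exp (- (real n * d))"
  proof eventually_elim
    case (elim n)
    have "bern_prob R p n K \<le> (\<Sum>x\<in>F. bern_prob R p n (V x))"
      using bern_prob_mono[OF p F(3)] bern_prob_UN[OF p F(2)] by (rule order_trans)
    also have "\<dots> \<le> (\<Sum>x\<in>F. exp (- (real n * d)))"
    proof (rule sum_mono)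
      fix x assume "x \<in> F"
      have "bern_prob R p n (V x) \<le> exp (- (real n * c' x))" using elim \<open>x \<in> F\<close> by blast
      also have "\<dots> \<le> exp (- (real n * d))" using d(2)[OF \<open>x \<in> F\<close>] by (simp add: mult_left_mono)
      finally show "bern_prob R p n (V x) \<le> exp (- (real n * d))" .
    qed
    also have "\<dots> \<le> (real (card F) + 1) * exp (- (real n * d))" by (simp add: algebra_simps)
    finally show ?case .
  qed
  then show ?thesis using d(1) by (intro exI[of _ "real (card F) + 1"] exI[of _ d] conjI) auto
qed

section \<open>Law of large numbers and the tilted lower bound\<close>

lemma legendre_deriv_0: "((\<lambda>t. t * x - ln (mgf R q t)) has_real_derivative x - R * (2 * q - 1)) (at 0)"
  unfolding mgf_def by (auto intro!: derivative_eq_intros simp: algebra_simps)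

text \<open>At \<open>t = 0\<close> the function \<open>t * x - ln (mgf R q t)\<close> vanishes with
  slope \<open>x\<close> minus the limiting mean. Away from the mean, a small \<open>t\<close> with
  the sign of that slope makes it positive, so the compact complement of \<open>G\<close> has
  exponentially small probability.\<close>

lemma bern_lln:
  assumes p: "range p \<subseteq> {0..1}" and q: "p \<longlonglongrightarrow> q" and R: "R > 0"
    and G: "open G" "R * (2 * q - 1) \<in> G"
  shows "(\<lambda>n. bern_prob R p n G) \<longlonglongrightarrow> 1"
proof -
  define K where "K = - G \<inter> {-R..R}"
  have "\<exists>t. 0 < t * x - ln (mgf R q t)" if "x \<in> K" for x
  proof -
    have "x \<noteq> R * (2 * q - 1)" using that G by (auto simp: K_def)
    then consider "x - R * (2 * q - 1) > 0" | "x - R * (2 * q - 1) < 0" by linarith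
    then show ?thesis
    proof cases
      case 1
      obtain d where "d > 0" "\<And>h. 0 < h \<Longrightarrow> h < d \<Longrightarrow> 0 < h * x - ln (mgf R q h)"
        using DERIV_pos_inc_right[OF legendre_deriv_0 1] by auto
      then show ?thesis using field_lbound_gt_zero[of d d] by blast
    next
      case 2
      obtain d where "d > 0" "\<And>h. 0 < h \<Longrightarrow> h < d \<Longrightarrow> 0 < (- h) * x - ln (mgf R q (- h))"
        using DERIV_neg_dec_left[OF legendre_deriv_0 2] by auto
      then show ?thesis using field_lbound_gt_zero[of d d] by blast
    qed
  qed
  moreover have "compact K" unfolding K_def using G
    by (intro closed_Int_compact) auto
  ultimately obtain C c' where C: "C > 0" "c' > 0"
    "\<forall>\<^sub>F n in sequentially. bern_prob R p n K \<le> C * exp (- (real n * c'))"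
    using bern_prob_compact_upper[OF p q, of K 0 R] by blast
  have "(\<lambda>n. C * exp (- (real n * c'))) \<longlonglongrightarrow> 0"
    using C by real_asymp
  then have "(\<lambda>n. bern_prob R p n K) \<longlonglongrightarrow> 0"
    by (rule tendsto_sandwich[rotated 3, where f = "\<lambda>_. 0"]) (use C(3) in \<open>auto simp: bern_prob_nonneg p\<close>)
  then have "(\<lambda>n. 1 - bern_prob R p n K) \<longlonglongrightarrow> 1 - 0" by (intro tendsto_diff tendsto_const)
  moreover have "\<forall>\<^sub>F n in sequentially. 1 - bern_prob R p n K = bern_prob R p n G"
    using eventually_gt_at_top[of 0]
    by eventually_elim (use bern_prob_restrict[of R _ p "- G"] R in \<open>simp add: K_def bern_prob_Compl\<close>)
  ultimately show ?thesis by (simp add: tendsto_cong)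
qed

text \<open>Exponential tilting, unlike a direct change to the limiting parameter, is harmless at sites
  whose parameter is 0 or 1.\<close>

lemma bern_prob_local_lower:
  assumes p: "range p \<subseteq> {0..1}" and q: "p \<longlonglongrightarrow> q" and R: "R > 0"
    and G: "open G" "x \<in> G" and x: "x = R * (2 * tilt R t q - 1)" and e: "e > 0"
  shows "\<forall>\<^sub>F n in sequentially. exp (- (real n * (t * x - ln (mgf R q t) + e))) \<le> bern_prob R p n G"
proof -
  \<comment> \<open>The additional half-line bounds the factor \<open>exp (n * t * z)\<close> from
    above on \<open>V\<close>, which is what is needed to undo the tilt there.\<close>
  define V where "V = G \<inter> {z. t * z < t * x + e / 4}"
  have V: "open V" "x \<in> V" "V \<subseteq> G"
    unfolding V_def using G e by (auto intro!: open_Int open_Collect_less continuous_intros)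
  let ?p = "\<lambda>k. tilt R t (p k)"
  have q01: "0 \<le> q" "q \<le> 1"
    using limit_unit_interval[OF p q] by auto
  have p': "range ?p \<subseteq> {0..1}" using tilt_bounds range_unit_interval[OF p] by fastforce
  have q': "?p \<longlonglongrightarrow> tilt R t q"
    using mgf_pos[OF q01, of R t] unfolding tilt_def mgf_def by (intro tendsto_intros q) auto
  \<comment> \<open>By assumption \<open>x\<close> is the mean of the tilted limit law, so the law
    of large numbers applies to its neighbourhood \<open>V\<close>.\<close>
  have "(\<lambda>n. bern_prob R ?p n V) \<longlonglongrightarrow> 1" using bern_lln[OF p' q' R V(1)] V(2) x by simp
  then have 1: "\<forall>\<^sub>F n in sequentially. bern_prob R ?p n V > 1 / 2" by (rule order_tendstoD) simp
  have 2: "\<forall>\<^sub>F n in sequentially. ln (mgf R q t) - e / 4 < (\<Sum>k<n. ln (mgf R (p k) t)) / real n"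
    using order_tendstoD(1)[OF ln_mgf_tendsto[OF p q]] e by simp
  have 3: "\<forall>\<^sub>F n in sequentially. exp (- (real n * (e / 2))) \<le> 1 / 2"
  proof -
    have "(\<lambda>n. exp (- (real n * (e / 2)))) \<longlonglongrightarrow> 0" using e by real_asymp
    then have "\<forall>\<^sub>F n in sequentially. exp (- (real n * (e / 2))) < 1 / 2" by (rule order_tendstoD) simp
    then show ?thesis by eventually_elim simp
  qed
  show ?thesis using 1 2 3 eventually_gt_at_top[of 0]
  proof eventually_elim
    case (elim n)
    define L where "L = (\<Sum>k<n. ln (mgf R (p k) t))"
    define E where "E = exp (real n * (t * x + e / 4))"
    \<comment> \<open>The loss \<open>e\<close> is spent as \<open>e / 4\<close> on the Cesaro
      limit, \<open>e / 4\<close> on the width of \<open>V\<close>, and \<open>e / 2\<close> on the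
      factor \<open>1 / 2\<close> from the law of large numbers.\<close>
    have "exp (- (real n * (t * x - ln (mgf R q t) + e)))
        = exp (real n * (ln (mgf R q t) - e / 4) - real n * (t * x + e / 4)) * exp (- (real n * (e / 2)))"
      by (simp add: algebra_simps flip: exp_add)
    also have "\<dots> \<le> exp (L - real n * (t * x + e / 4)) * (1 / 2)"
      using elim by (intro mult_mono) (auto simp: L_def field_simps)
    also have "\<dots> \<le> exp (L - real n * (t * x + e / 4)) * bern_prob R ?p n V"
      using elim by (intro mult_left_mono) auto
    also have "\<dots> = (\<Sum>U | U \<subseteq> {..<n} \<and> spin_val R n U \<in> V. bern ?p n U * (\<Prod>k<n. mgf R (p k) t)) / E"
      using prod_mgf_eq_exp[OF p, where R = R and t = t and n = n]
      by (simp add: exp_diff L_def E_def bern_prob_def flip: sum_distrib_right)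
    also have "\<dots> \<le> (\<Sum>U | U \<subseteq> {..<n} \<and> spin_val R n U \<in> V. bern p n U * E) / E"
    proof (rule divide_right_mono[OF sum_mono])
      fix U assume U: "U \<in> {U. U \<subseteq> {..<n} \<and> spin_val R n U \<in> V}"
      have "bern ?p n U * (\<Prod>k<n. mgf R (p k) t) = bern p n U * exp (real n * (t * spin_val R n U))"
        using bern_tilt[OF p] U elim by blast
      also have "\<dots> \<le> bern p n U * E"
        unfolding E_def using U bern_nonneg[OF p] by (intro mult_left_mono) (auto simp: V_def intro!: mult_left_mono)
      finally show "bern ?p n U * (\<Prod>k<n. mgf R (p k) t) \<le> bern p n U * E" .
    qed (simp add: E_def)
    also have "\<dots> = bern_prob R p n V"
      by (simp add: bern_prob_def E_def flip: sum_distrib_right)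
    also have "\<dots> \<le> bern_prob R p n G" using bern_prob_mono[OF p V(3)] .
    finally show ?case .
  qed
qed

section \<open>The rate function as a convex conjugate\<close>

lemma spin_rate_outside: "\<bar>x\<bar> > norm \<nu> \<Longrightarrow> spin_rate \<nu> v x = \<infinity>"
  by (simp add: spin_rate_def)

lemma eln_ereal: "0 < x \<Longrightarrow> eln (ereal x) = ereal (ln x)"
  by (simp add: eln_def)

lemma eln_0 [simp]: "eln 0 = - \<infinity>" and eln_infinity [simp]: "eln \<infinity> = \<infinity>"
  by (simp_all add: eln_def)

lemma eln_1 [simp]: "eln 1 = 0"
  by (simp add: eln_def one_ereal_def zero_ereal_def)

text \<open>The real formula is valid on the closed interval: at an end point the extended product
  is 0 times minus infinity, which is 0, and the real term also vanishes because its first factor is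
  0.\<close>

lemma spin_rate_interior:
  assumes m: "\<bar>\<nu> \<bullet> v\<bar> < norm \<nu>" and x: "\<bar>x\<bar> \<le> norm \<nu>"
  shows "spin_rate \<nu> v x = ereal (1/2 * ((1 + x / norm \<nu>) * ln ((norm \<nu> + x) / (norm \<nu> + \<nu> \<bullet> v))
     + (1 - x / norm \<nu>) * ln ((norm \<nu> - x) / (norm \<nu> - \<nu> \<bullet> v))))"
proof -
  let ?R = "norm \<nu>" and ?m = "\<nu> \<bullet> v"
  have pos: "?R > 0" "?R + ?m > 0" "?R - ?m > 0" using m by auto
  have 1: "ereal (1 + x / ?R) * eln (ereal (?R + x) / ereal (?R + ?m))
      = ereal ((1 + x / ?R) * ln ((?R + x) / (?R + ?m)))"
  proof (cases "x = - ?R")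
    case False
    then have "?R + x > 0" using x by auto
    then show ?thesis using pos by (simp add: eln_ereal)
  qed (use pos in \<open>simp add: zero_ereal_def[symmetric]\<close>)
  have 2: "ereal (1 - x / ?R) * eln (ereal (?R - x) / ereal (?R - ?m))
      = ereal ((1 - x / ?R) * ln ((?R - x) / (?R - ?m)))"
  proof (cases "x = ?R")
    case False
    then have "?R - x > 0" using x by auto
    then show ?thesis using pos by (simp add: eln_ereal)
  qed (use pos in \<open>simp add: zero_ereal_def[symmetric]\<close>)
  show ?thesis unfolding spin_rate_def 1 2 using x by simp
qed

text \<open>Relative entropy with respect to a point mass at \<open>R\<close>. For
  \<open>x < R\<close> the second logarithm is infinite with a positive factor, while the first term
  is never minus infinity, so the sum is well behaved; at \<open>x = R\<close> both terms are
  0.\<close>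

lemma relative_entropy_degenerate:
  assumes R: "R > 0" and x: "\<bar>x\<bar> \<le> R"
  shows "ereal (1/2) * (ereal (1 + x / R) * eln (ereal (R + x) / ereal (R + R))
    + ereal (1 - x / R) * eln (ereal (R - x) / 0)) = (if x = R then 0 else \<infinity>)"
proof (cases "x = R")
  case True
  have "ereal (R + R) / ereal (R + R) = ereal 1" using R by simp
  then show ?thesis using True R by (simp add: zero_ereal_def[symmetric] eln_ereal)
next
  case False
  then have "R - x > 0" "1 - x / R > 0" using R x by (auto simp: field_simps)
  then have 2: "ereal (1 - x / R) * eln (ereal (R - x) / 0) = \<infinity>" by (simp add: divide_ereal_def)
  have 1: "ereal (1 + x / R) * eln (ereal (R + x) / ereal (R + R)) \<noteq> - \<infinity>"
  proof (cases "x = - R")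
    case False
    then have "R + x > 0" using x by auto
    then show ?thesis using R by (simp add: eln_ereal)
  qed (use R in \<open>simp add: zero_ereal_def[symmetric]\<close>)
  show ?thesis using 1 False unfolding 2 by simp
qed

lemma spin_rate_degenerate:
  assumes "\<nu> \<noteq> 0"
  shows "\<nu> \<bullet> v = norm \<nu> \<Longrightarrow> spin_rate \<nu> v x = (if x = norm \<nu> then 0 else \<infinity>)"
    and "\<nu> \<bullet> v = - norm \<nu> \<Longrightarrow> spin_rate \<nu> v x = (if x = - norm \<nu> then 0 else \<infinity>)"
proof -
  have R: "norm \<nu> > 0" using assms by simp
  {
    assume "\<nu> \<bullet> v = norm \<nu>"
    then show "spin_rate \<nu> v x = (if x = norm \<nu> then 0 else \<infinity>)"
      using relative_entropy_degenerate[OF R, of x]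
      by (cases "\<bar>x\<bar> \<le> norm \<nu>") (auto simp: spin_rate_def zero_ereal_def[symmetric] simp del: ereal_divide)
  next
    assume "\<nu> \<bullet> v = - norm \<nu>"
    then show "spin_rate \<nu> v x = (if x = - norm \<nu> then 0 else \<infinity>)"
      \<comment> \<open>Replacing \<open>x\<close> by \<open>- x\<close> exchanges the two terms of
        the formula and the two ends of the interval.\<close>
      using relative_entropy_degenerate[OF R, of "- x"]
      by (cases "\<bar>x\<bar> \<le> norm \<nu>") (auto simp: spin_rate_def zero_ereal_def[symmetric] add.commute simp del: ereal_divide)
  }
qed

locale spin_direction =
  fixes \<nu> v :: "real^3"
  assumes nonzero: "\<nu> \<noteq> 0" and mean_bound: "\<bar>\<nu> \<bullet> v\<bar> \<le> norm \<nu>"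
begin

definition R where "R = norm \<nu>"
definition q where "q = (1 + \<nu> \<bullet> v / norm \<nu>) / 2"
abbreviation cgf where "cgf \<equiv> \<lambda>t. ln (mgf R q t)"
abbreviation rate where "rate \<equiv> spin_rate \<nu> v"

lemma R_pos: "R > 0"
  using nonzero by (simp add: R_def)

lemma q_bounds: "0 \<le> q" "q \<le> 1"
  using mean_bound R_pos by (auto simp: q_def R_def field_simps abs_le_iff)

lemma inner_eq: "\<nu> \<bullet> v = R * (2 * q - 1)"
  using nonzero unfolding q_def R_def by (simp add: field_simps)

lemma rate_outside: "\<bar>x\<bar> > R \<Longrightarrow> rate x = \<infinity>"
  using spin_rate_outside by (simp add: R_def)

lemma rate_0: "q = 0 \<Longrightarrow> rate x = (if x = - R then 0 else \<infinity>)"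
  using spin_rate_degenerate(2)[OF nonzero, of v x] inner_eq by (simp add: R_def)

lemma rate_1: "q = 1 \<Longrightarrow> rate x = (if x = R then 0 else \<infinity>)"
  using spin_rate_degenerate(1)[OF nonzero, of v x] inner_eq by (simp add: R_def)

text \<open>In the coordinate \<open>y\<close>, the weight of \<open>+R\<close> in the two-point law
  with mean \<open>R * (2 * y - 1)\<close>, the rate is the relative entropy of the Bernoulli law of
  \<open>y\<close> with respect to that of \<open>q\<close>.\<close>

lemma rate_interior:
  assumes q: "0 < q" "q < 1" and y: "0 \<le> y" "y \<le> 1"
  shows "rate (R * (2 * y - 1)) = ereal (y * ln (y / q) + (1 - y) * ln ((1 - y) / (1 - q)))"
proof -
  have m: "\<bar>\<nu> \<bullet> v\<bar> < norm \<nu>"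
  proof -
    have "\<bar>2 * q - 1\<bar> < 1" using q by auto
    then have "R * \<bar>2 * q - 1\<bar> < R * 1" using R_pos by (intro mult_strict_left_mono)
    then show ?thesis using R_pos by (simp add: inner_eq abs_mult R_def[symmetric])
  qed
  have x: "\<bar>R * (2 * y - 1)\<bar> \<le> norm \<nu>"
  proof -
    have "\<bar>2 * y - 1\<bar> \<le> 1" using y by auto
    then have "R * \<bar>2 * y - 1\<bar> \<le> R * 1" using R_pos by (intro mult_left_mono) auto
    then show ?thesis using R_pos by (simp add: abs_mult R_def[symmetric])
  qed
  have ratio: "(R + R * (2 * y - 1)) / (R + R * (2 * q - 1)) = y / q"
       "(R - R * (2 * y - 1)) / (R - R * (2 * q - 1)) = (1 - y) / (1 - q)"
    using R_pos q by (simp_all add: field_simps)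
  have scale: "R * (2 * y - 1) / R = 2 * y - 1" using R_pos by simp
  show ?thesis
    unfolding spin_rate_interior[OF m x] inner_eq R_def[symmetric] ratio scale by (simp add: field_simps)
qed

text \<open>Pulling the dominant exponential out of \<open>mgf\<close> turns the conjugate
  expression at an end point into an explicit function of \<open>t\<close>, from which both its
  upper bound and its limit at infinity can be read off.\<close>

lemma cgf_at_end:
  "t * R - cgf t = - ln (q + (1 - q) * exp (- (2 * t * R)))"
  "t * (- R) - cgf t = - ln ((1 - q) + q * exp (2 * t * R))"
proof -
  have 1: "mgf R q t = exp (t * R) * (q + (1 - q) * exp (- (2 * t * R)))"
   and 2: "mgf R q t = exp (- (t * R)) * ((1 - q) + q * exp (2 * t * R))"
    by (simp_all add: mgf_def algebra_simps flip: exp_add)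
  have pos: "q + (1 - q) * exp (- (2 * t * R)) > 0" "(1 - q) + q * exp (2 * t * R) > 0"
    using q_bounds by (cases "q = 0"; simp add: add_pos_nonneg)
      (use q_bounds in \<open>cases "q = 1"; simp add: add_pos_nonneg\<close>)
  show "t * R - cgf t = - ln (q + (1 - q) * exp (- (2 * t * R)))"
    unfolding 1 using pos by (simp only: ln_mult_pos exp_gt_zero ln_exp; simp)
  show "t * (- R) - cgf t = - ln ((1 - q) + q * exp (2 * t * R))"
    unfolding 2 using pos by (simp only: ln_mult_pos exp_gt_zero ln_exp; simp)
qed

text \<open>Log-sum inequality: \<open>a + b\<close> is the convex combination of
  \<open>a / y\<close> and \<open>b / (1 - y)\<close> with weights \<open>y\<close> and
  \<open>1 - y\<close>, and \<open>ln\<close> is concave.\<close>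

lemma ln_add_ge_relative_entropy:
  fixes a b y :: real
  assumes "0 < a" "0 < b" "0 < y" "y < 1"
  shows "y * ln (a / y) + (1 - y) * ln (b / (1 - y)) \<le> ln (a + b)"
proof -
  have "(1 - y) * ln (b / (1 - y)) + y * ln (a / y) \<le> ln ((1 - y) *\<^sub>R (b / (1 - y)) + y *\<^sub>R (a / y))"
    using concave_onD[OF ln_concave, of y "b / (1 - y)" "a / y"] assms by simp
  then show ?thesis using assms by (simp add: add.commute)
qed

lemma fenchel: "ereal (t * x - cgf t) \<le> rate x"
proof (cases "\<bar>x\<bar> > R")
  case True then show ?thesis by (simp add: rate_outside)
next
  case False
  define y where "y = (1 + x / R) / 2"
  have x: "x = R * (2 * y - 1)" using R_pos by (simp add: y_def field_simps)
  have y: "0 \<le> y" "y \<le> 1" using False R_pos by (auto simp: y_def field_simps)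
  consider "q = 0" | "q = 1" | "0 < q" "q < 1" using q_bounds by fastforce
  then show ?thesis
  proof cases
    case 3
    have "t * x - cgf t \<le> y * ln (y / q) + (1 - y) * ln ((1 - y) / (1 - q))"
    proof -
      consider "y = 0" | "y = 1" | "0 < y" "y < 1" using y by fastforce
      then show ?thesis
      proof cases
        case 1
        have "t * (- R) - cgf t \<le> - ln (1 - q)"
          unfolding cgf_at_end using 3 by (intro le_imp_neg_le ln_mono) auto
        then show ?thesis using 1 3 x by (simp add: ln_div)
      next
        case 2
        have "t * R - cgf t \<le> - ln q"
          unfolding cgf_at_end using 3 by (intro le_imp_neg_le ln_mono) auto
        then show ?thesis using 2 3 x by (simp add: ln_div)
      next
        case y: 3
        \<comment> \<open>The log-sum inequality is applied to the two summands of
          \<open>mgf R q t\<close>; separating the exponentials produces \<open>t * x\<close> minus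
          the relative entropy.\<close>
        have "y * ln (q * exp (t * R) / y) + (1 - y) * ln ((1 - q) * exp (- (t * R)) / (1 - y)) \<le> cgf t"
          unfolding mgf_def using 3 y by (intro ln_add_ge_relative_entropy) auto
        moreover have "y * ln (q * exp (t * R) / y) + (1 - y) * ln ((1 - q) * exp (- (t * R)) / (1 - y))
          = t * x - (y * ln (y / q) + (1 - y) * ln ((1 - y) / (1 - q)))"
          using 3 y by (simp add: ln_div ln_mult_pos x) (simp add: algebra_simps)
        ultimately show ?thesis by simp
      qed
    qed
    then show ?thesis using rate_interior[OF 3 y] x by simp
  qed (auto simp: rate_0 rate_1 mgf_def)
qed

text \<open>For \<open>0 < q < 1\<close> every interior \<open>x\<close> is the mean of a tilted
  law, and that tilt attains the supremum in the conjugate.\<close>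

lemma conjugate_point:
  assumes q: "0 < q" "q < 1" and y: "0 < y" "y < 1"
  defines "x \<equiv> R * (2 * y - 1)"
  shows "\<exists>t. R * (2 * tilt R t q - 1) = x \<and> rate x = ereal (t * x - cgf t)"
proof -
  \<comment> \<open>Solves \<open>tilt R t q = y\<close>: tilting multiplies the odds
    \<open>q / (1 - q)\<close> by \<open>exp (2 * t * R)\<close>, so \<open>t\<close> is the
    difference of the log odds of \<open>y\<close> and \<open>q\<close>, divided by
    \<open>2 * R\<close>.\<close>
  define t where "t = ln (y * (1 - q) / ((1 - y) * q)) / (2 * R)"
  define E where "E = exp (t * R)"
  have E: "E > 0" by (simp add: E_def)
  have "E * E = exp (ln (y * (1 - q) / ((1 - y) * q)))"
    using R_pos by (simp add: E_def t_def flip: exp_add)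
  then have EE: "E * E = y * (1 - q) / ((1 - y) * q)" using q y by simp
  have "mgf R q t = q * E + (1 - q) / E" by (simp add: mgf_def E_def exp_minus divide_inverse)
  also have "(1 - q) / E = E * ((1 - q) / (E * E))" using E by simp
  also have "\<dots> = E * ((1 - y) * q / y)" unfolding EE using q y by simp
  finally have M: "mgf R q t = E * (q / y)" using y by (simp add: field_simps)
  have "tilt R t q = y" using E q y unfolding tilt_def M by (simp add: E_def)
  moreover have "t * x - cgf t = y * ln (y / q) + (1 - y) * ln ((1 - y) / (1 - q))"
  proof -
    have "cgf t = t * R + ln (q / y)" using q y by (simp add: M E_def ln_mult_pos ln_div)
    then have "t * x - cgf t = 2 * (t * R) * (y - 1) - ln (q / y)" by (simp add: x_def algebra_simps)
    also have "2 * (t * R) = ln (y * (1 - q) / ((1 - y) * q))" using R_pos by (simp add: t_def)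
    finally show ?thesis using q y by (simp add: ln_div ln_mult_pos) (simp add: algebra_simps)
  qed
  ultimately show ?thesis using rate_interior[OF q, of y] y by (intro exI[of _ t]) (simp add: x_def)
qed

text \<open>With \<open>fenchel\<close> this says that the rate is the supremum of
  \<open>t * x - cgf t\<close>. The strict form is required since the supremum is infinite outside
  the interval and, for \<open>0 < q < 1\<close>, not attained at its ends.\<close>

lemma duality:
  assumes "ereal c < rate x"
  shows "\<exists>t. c < t * x - cgf t"
proof -
  \<comment> \<open>A linear function of \<open>t\<close> with non-zero slope exceeds every bound;
    the chosen \<open>t\<close> makes the minorant equal to \<open>c + 1\<close>.\<close>
  have escape: "\<exists>t. c < t * x - cgf t" if "\<And>t. t * a - b \<le> t * x - cgf t" "a \<noteq> 0" for a b
    using that(1)[of "(c + b + 1) / a"] that(2) by (intro exI[of _ "(c + b + 1) / a"]) simp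
  have mgf_le: "mgf R q t \<le> exp (\<bar>t\<bar> * R)" for t
  proof -
    have "mgf R q t \<le> q * exp (\<bar>t\<bar> * R) + (1 - q) * exp (\<bar>t\<bar> * R)"
      unfolding mgf_def using q_bounds R_pos
      by (intro add_mono mult_left_mono) (auto simp: abs_if mult_nonneg_nonneg mult_nonpos_nonneg)
    then show ?thesis by (simp add: algebra_simps)
  qed
  have cgf_le: "cgf t \<le> \<bar>t\<bar> * R" for t
    using mgf_le[of t] mgf_pos[OF q_bounds, of R t] by (metis ln_exp ln_le_cancel_iff exp_gt_zero)
  consider "\<bar>x\<bar> > R" | "\<bar>x\<bar> \<le> R" "q = 0" | "\<bar>x\<bar> \<le> R" "q = 1" | "\<bar>x\<bar> \<le> R" "0 < q" "q < 1"
    using q_bounds by fastforce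
  then show ?thesis
  proof cases
    case 1
    \<comment> \<open>With the sign of \<open>x\<close> given to \<open>t\<close>, the bound
      \<open>cgf t \<le> \<bar>t\<bar> * R\<close> leaves \<open>s * (\<bar>x\<bar> - R)\<close>,
      which this \<open>s\<close> makes equal to \<open>\<bar>c\<bar> + 1\<close>.\<close>
    define s where "s = (\<bar>c\<bar> + 1) / (\<bar>x\<bar> - R)"
    define t where "t = s * sgn x"
    have "s > 0" using 1 by (simp add: s_def)
    moreover have "x \<noteq> 0" using 1 R_pos by auto
    ultimately have "t * x = s * \<bar>x\<bar>" "\<bar>t\<bar> = s"
      by (simp_all add: t_def abs_mult abs_sgn_eq sgn_if)
    then have "t * x - \<bar>t\<bar> * R = s * (\<bar>x\<bar> - R)" by (simp add: algebra_simps)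
    also have "\<dots> = \<bar>c\<bar> + 1" using 1 by (simp add: s_def)
    finally show ?thesis using cgf_le[of t] by (intro exI[of _ t]) linarith
  next
    case 2
    show ?thesis
    proof (cases "x = - R")
      case True
      then show ?thesis using assms 2 by (intro exI[of _ 0]) (simp add: rate_0)
    next
      case False
      then show ?thesis using 2 by (intro escape[of "x + R" 0]) (simp_all add: mgf_def algebra_simps)
    qed
  next
    case 3
    show ?thesis
    proof (cases "x = R")
      case True
      then show ?thesis using assms 3 by (intro exI[of _ 0]) (simp add: rate_1)
    next
      case False
      then show ?thesis using 3 by (intro escape[of "x - R" 0]) (simp_all add: mgf_def algebra_simps)
    qed
  next
    case 4
    consider "x = R" | "x = - R" | "\<bar>x\<bar> < R" using 4 by linarith
    then show ?thesis
    proof cases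
      case 1
      have "c < - ln q" using assms rate_interior[of 1] 4 1 by (simp add: ln_div)
      \<comment> \<open>The value at the end \<open>R\<close> is the limit as \<open>t\<close> tends
        to infinity; the end \<open>-R\<close> is handled with \<open>t\<close> tending to minus
        infinity.\<close>
      moreover have "((\<lambda>t. - ln (q + (1 - q) * exp (- (2 * t * R)))) \<longlongrightarrow> - ln (q + (1 - q) * 0)) at_top"
        using R_pos 4 by (intro tendsto_intros) (real_asymp | simp)+
      ultimately have "\<forall>\<^sub>F t in at_top. c < t * R - cgf t"
        unfolding cgf_at_end using order_tendstoD(1) by fastforce
      then show ?thesis unfolding 1 using eventually_happens by force
    next
      case 2
      have "c < - ln (1 - q)" using assms rate_interior[of 0] 4 2 by (simp add: ln_div)
      moreover have "((\<lambda>t. - ln ((1 - q) + q * exp (2 * t * R))) \<longlongrightarrow> - ln ((1 - q) + q * 0)) at_bot"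
        using R_pos 4 by (intro tendsto_intros) (real_asymp | simp)+
      ultimately have "\<forall>\<^sub>F t in at_bot. c < t * (- R) - cgf t"
        unfolding cgf_at_end using order_tendstoD(1) by fastforce
      then show ?thesis unfolding 2 using eventually_happens by force
    next
      case 3
      define y where "y = (1 + x / R) / 2"
      have "x = R * (2 * y - 1)" using R_pos by (simp add: y_def field_simps)
      moreover have "0 < y" "y < 1" using 3 R_pos by (auto simp: y_def field_simps)
      ultimately show ?thesis using conjugate_point[of y] 4 assms by force
    qed
  qed
qed

text \<open>The local lower bound only speaks of means of tilted laws. For \<open>0 < q < 1\<close>
  these fill the open interval, and an end point in \<open>G\<close> is approximated from inside.
  For \<open>q\<close> equal to 0 or 1 the only point of finite rate is the untilted mean, so
  \<open>t = 0\<close> serves.\<close>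

lemma exposed_near:
  assumes "rate x \<noteq> \<infinity>" "open G" "x \<in> G"
  shows "\<exists>t. R * (2 * tilt R t q - 1) \<in> G \<and> ereal (t * (R * (2 * tilt R t q - 1)) - cgf t) \<le> rate x"
proof -
  have xR: "\<bar>x\<bar> \<le> R" using assms rate_outside by force
  consider "q = 0" | "q = 1" | "0 < q" "q < 1" using q_bounds by fastforce
  then show ?thesis
  proof cases
    case 1
    then show ?thesis using assms by (intro exI[of _ 0]) (auto simp: rate_0 tilt_def split: if_splits)
  next
    case 2
    then show ?thesis using assms by (intro exI[of _ 0]) (auto simp: rate_1 tilt_def split: if_splits)
  next
    case 3
    let ?x = "\<lambda>t. R * (2 * tilt R t q - 1)"
    have tilt_alt: "tilt R t q = q / (q + (1 - q) * exp (- (2 * t * R)))"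
      "tilt R t q = q * exp (2 * t * R) / (q * exp (2 * t * R) + (1 - q))" for t
    proof -
      have 1: "mgf R q t = exp (t * R) * (q + (1 - q) * exp (- (2 * t * R)))"
       and 2: "mgf R q t = exp (- (t * R)) * (q * exp (2 * t * R) + (1 - q))"
        by (simp_all add: mgf_def algebra_simps flip: exp_add)
      have "exp (t * R) = exp (- (t * R)) * exp (2 * t * R)" by (simp flip: exp_add)
      then show "tilt R t q = q * exp (2 * t * R) / (q * exp (2 * t * R) + (1 - q))"
        unfolding tilt_def 2 by simp
      show "tilt R t q = q / (q + (1 - q) * exp (- (2 * t * R)))"
        unfolding tilt_def 1 by simp
    qed
    have t01: "0 \<le> tilt R t q" "tilt R t q \<le> 1" for t using tilt_bounds q_bounds by auto
    consider "x = R" | "x = - R" | "\<bar>x\<bar> < R" using xR by linarith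
    then show ?thesis
    proof cases
      case 1
      have "((\<lambda>t. R * (2 * (q / (q + (1 - q) * exp (- (2 * t * R)))) - 1)) \<longlongrightarrow> R * (2 * (q / (q + (1 - q) * 0)) - 1)) at_top"
        using R_pos 3 by (intro tendsto_intros) (real_asymp | simp)+
      then have "\<forall>\<^sub>F t in at_top. ?x t \<in> G"
        using topological_tendstoD[OF _ assms(2)] assms(3) 3 1 by (simp add: tilt_alt)
      then have "\<forall>\<^sub>F t in at_top. ?x t \<in> G \<and> t > 0"
        using eventually_gt_at_top[of 0] by eventually_elim simp
      then obtain t where t: "?x t \<in> G" "t > 0" using eventually_happens by force
      \<comment> \<open>Because \<open>t\<close> is positive, moving from the tilted mean out to
        \<open>R\<close> can only increase \<open>t * x - cgf t\<close>, and \<open>fenchel\<close>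
        bounds the result by the rate at \<open>R\<close>.\<close>
      have "?x t \<le> R" using t01[of t] R_pos by simp
      then have "t * ?x t - cgf t \<le> t * R - cgf t" using t by simp
      then have "ereal (t * ?x t - cgf t) \<le> ereal (t * R - cgf t)" by simp
      also have "\<dots> \<le> rate x" using fenchel[of t x] 1 by simp
      finally show ?thesis using t by blast
    next
      case 2
      have "((\<lambda>t. R * (2 * (q * exp (2 * t * R) / (q * exp (2 * t * R) + (1 - q))) - 1))
          \<longlongrightarrow> R * (2 * (q * 0 / (q * 0 + (1 - q))) - 1)) at_bot"
        using R_pos 3 by (intro tendsto_intros) (real_asymp | simp)+
      then have "\<forall>\<^sub>F t in at_bot. ?x t \<in> G"
        unfolding tilt_alt(2) using topological_tendstoD[OF _ assms(2)] assms(3) 3 2 by fastforce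
      then have "\<forall>\<^sub>F t in at_bot. ?x t \<in> G \<and> t < 0"
        using eventually_gt_at_bot[of 0] by eventually_elim simp
      then obtain t where t: "?x t \<in> G" "t < 0" using eventually_happens by force
      have "- R \<le> ?x t" using t01[of t] R_pos by (simp add: algebra_simps)
      then have "t * ?x t - cgf t \<le> t * (- R) - cgf t" using t mult_left_mono_neg[of "- R" "?x t" t] by simp
      then have "ereal (t * ?x t - cgf t) \<le> ereal (t * (- R) - cgf t)" by simp
      also have "\<dots> \<le> rate x" using fenchel[of t x] 2 by simp
      finally show ?thesis using t by blast
    next
      case x: 3
      define y where "y = (1 + x / R) / 2"
      have "x = R * (2 * y - 1)" using R_pos by (simp add: y_def field_simps)
      moreover have "0 < y" "y < 1" using x R_pos by (auto simp: y_def field_simps)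
      ultimately show ?thesis using conjugate_point[of y] 3 assms by force
    qed
  qed
qed

section \<open>Goodness of the rate and the large deviation principle for two-valued
  variables\<close>

lemma rate_le_iff: "rate x \<le> ereal a \<longleftrightarrow> (\<forall>t. t * x - cgf t \<le> a)"
  using duality[of a x] fenchel[of _ x] by (meson ereal_less_eq(3) leD not_le_imp_less order_trans)

text \<open>A supremum of affine functions is lower semicontinuous, and its level sets are
  intersections of closed half-lines; these lie in \<open>{-R..R}\<close> because the rate is
  infinite outside.\<close>

lemma good_rate: "good_rate_function rate"
  unfolding good_rate_function_def
proof (intro conjI allI impI)
  show "0 \<le> rate x" for x using fenchel[of 0 x] by (simp add: zero_ereal_def)
next
  fix x show "rate x \<le> Liminf (at x) rate"
  proof (rule ccontr)
    assume "\<not> rate x \<le> Liminf (at x) rate"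
    then obtain c where c: "Liminf (at x) rate < ereal c" "ereal c < rate x"
      using ereal_dense2 by (metis not_le)
    obtain t where t: "c < t * x - cgf t" using duality[OF c(2)] by blast
    have "((\<lambda>y. t * y - cgf t) \<longlongrightarrow> t * x - cgf t) (at x)" by (intro tendsto_intros)
    then have "\<forall>\<^sub>F y in at x. c < t * y - cgf t" using t by (rule order_tendstoD)
    then have "\<forall>\<^sub>F y in at x. ereal c \<le> rate y"
    proof eventually_elim
      case (elim y)
      then have "ereal c \<le> ereal (t * y - cgf t)" by simp
      also have "\<dots> \<le> rate y" by (rule fenchel)
      finally show ?case .
    qed
    then have "ereal c \<le> Liminf (at x) rate" by (rule Liminf_bounded)
    then show False using c by simp
  qed
next
  fix a :: real
  have "x \<in> {-R..R}" if "rate x \<le> ereal a" for x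
    using that rate_outside[of x] by (cases "\<bar>x\<bar> > R") auto
  then have eq: "{x. rate x \<le> ereal a} = (\<Inter>t. {x. t * x - cgf t \<le> a}) \<inter> {-R..R}"
    using rate_le_iff by blast
  show "compact {x. rate x \<le> ereal a}" unfolding eq
    by (intro closed_Int_compact closed_INT ballI closed_Collect_le continuous_intros) auto
qed

theorem bernoulli_large_deviations:
  assumes p: "range p \<subseteq> {0..1}" and lim: "p \<longlonglongrightarrow> q"
    and \<mu>: "\<And>n B. n > 0 \<Longrightarrow> B \<in> sets borel \<Longrightarrow> measure (\<mu> n) B = bern_prob R p n B"
  shows "large_deviation_principle \<mu> real rate"
  unfolding large_deviation_principle_def
proof (intro conjI ballI)
  show "\<forall>n\<ge>1. 0 < real n" by simp
  show "mono_on {1..} real" by (simp add: mono_on_def)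
  show "filterlim real at_top sequentially" by (rule filterlim_real_sequentially)
  show "good_rate_function rate" by (rule good_rate)
next
  fix B :: "real set" assume B: "B \<in> sets borel"
  let ?P = "\<lambda>n. ereal (1 / real n) * eln (ereal (measure (\<mu> n) B))"
  show "- (INF x\<in>interior B. rate x) \<le> liminf ?P"
  proof -
    have "- rate x \<le> liminf ?P" if x: "x \<in> interior B" for x
    proof (cases "rate x = \<infinity>")
      case False
      obtain t where t: "R * (2 * tilt R t q - 1) \<in> interior B"
        "ereal (t * (R * (2 * tilt R t q - 1)) - cgf t) \<le> rate x"
        using exposed_near[OF False open_interior x] by blast
      define a where "a = t * (R * (2 * tilt R t q - 1)) - cgf t"
      have lower: "ereal (- a - e) \<le> liminf ?P" if e: "e > 0" for e
      proof (rule Liminf_bounded)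
        show "\<forall>\<^sub>F n in sequentially. ereal (- a - e) \<le> ?P n"
          using bern_prob_local_lower[OF p lim R_pos open_interior t(1) refl e] eventually_gt_at_top[of 0]
        proof eventually_elim
          case (elim n)
          define P where "P = measure (\<mu> n) B"
          have "exp (- (real n * (a + e))) \<le> bern_prob R p n (interior B)"
            using elim by (simp add: a_def)
          also have "\<dots> \<le> bern_prob R p n B"
            by (rule bern_prob_mono[OF p interior_subset])
          also have "\<dots> = P" using \<mu> elim B by (simp add: P_def)
          finally have le: "exp (- (real n * (a + e))) \<le> P" .
          then have P: "P > 0" by (meson exp_gt_zero less_le_trans)
          have "- (real n * (a + e)) \<le> ln P" using le P by (simp add: ln_ge_iff)
          then have "- a - e \<le> 1 / real n * ln P" using elim by (simp add: field_simps)
          then show ?case using P by (simp add: P_def[symmetric] eln_ereal)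
        qed
      qed
      have "ereal (- a) \<le> liminf ?P"
      proof (rule dense_le)
        fix z assume z: "z < ereal (- a)"
        show "z \<le> liminf ?P"
        proof (cases z)
          case (real b)
          then show ?thesis using lower[of "- a - b"] z by simp
        qed (use z in auto)
      qed
      moreover have "- rate x \<le> - ereal a" unfolding a_def ereal_minus_le_minus by (rule t(2))
      ultimately show ?thesis by simp
    qed simp
    then have "- liminf ?P \<le> (INF x\<in>interior B. rate x)"
      by (intro INF_greatest) (metis ereal_uminus_le_reorder)
    then show ?thesis by (metis ereal_uminus_le_reorder)
  qed
  show "limsup ?P \<le> - (INF x\<in>closure B. rate x)"
  proof (rule dense_ge)
    fix z assume "- (INF x\<in>closure B. rate x) < z"
    then have z: "- z < (INF x\<in>closure B. rate x)" by (metis ereal_uminus_less_reorder)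
    show "limsup ?P \<le> z"
    proof (cases "- z")
      case (real c)
      have "\<exists>t. c < t * x - cgf t" if "x \<in> closure B \<inter> {-R..R}" for x
        using that z real by (intro duality) (auto simp: less_INF_D)
      then obtain C c' where C: "C > 0" "c' > c" 
        and le: "\<forall>\<^sub>F n in sequentially. bern_prob R p n (closure B \<inter> {-R..R}) \<le> C * exp (- (real n * c'))"
        using bern_prob_compact_upper[OF p lim, of "closure B \<inter> {-R..R}" c R]
        by (meson closed_Int_compact closed_closure compact_Icc)
      \<comment> \<open>The prefactor \<open>C\<close> contributes \<open>ln C / n\<close>, which
        eventually fits into the strict gap between \<open>c\<close> and \<open>c'\<close>.\<close>
      have "(\<lambda>n. ln C / real n) \<longlonglongrightarrow> 0" by real_asymp
      then have "\<forall>\<^sub>F n in sequentially. ln C / real n < c' - c"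
        by (rule order_tendstoD) (use C in simp)
      with le have "\<forall>\<^sub>F n in sequentially. ?P n \<le> z" using eventually_gt_at_top[of 0]
      proof eventually_elim
        case (elim n)
        define P where "P = measure (\<mu> n) B"
        have "P = bern_prob R p n B" using \<mu> elim B by (simp add: P_def)
        also have "\<dots> \<le> bern_prob R p n (closure B)" by (rule bern_prob_mono[OF p closure_subset])
        also have "\<dots> = bern_prob R p n (closure B \<inter> {-R..R})"
          using bern_prob_restrict elim R_pos by simp
        also have "\<dots> \<le> C * exp (- (real n * c'))" using elim by simp
        finally have le: "P \<le> C * exp (- (real n * c'))" .
        have zc: "z = ereal (- c)" using real by (metis ereal_uminus_eq_reorder uminus_ereal.simps(1))
        show ?case
        proof (cases "P > 0")
          case True
          then have "ln P \<le> ln (C * exp (- (real n * c')))" using le C by simp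
          also have "\<dots> = ln C - real n * c'" using C by (simp add: ln_mult_pos)
          finally have "1 / real n * ln P \<le> ln C / real n - c'" using elim by (simp add: field_simps)
          also have "\<dots> \<le> - c" using elim by simp
          finally show ?thesis using True by (simp add: P_def[symmetric] eln_ereal zc)
        next
          case False
          \<comment> \<open>A set of probability 0 has logarithm minus infinity, and the upper bound
            is trivial.\<close>
          then have "eln (ereal P) = - \<infinity>" by (simp add: eln_def zero_ereal_def)
          then show ?thesis using elim by (simp add: P_def[symmetric])
        qed
      qed
      then show ?thesis by (rule Limsup_bounded)
    next
      case PInf
      then show ?thesis using z by simp
    next
      case MInf
      then show ?thesis by (metis ereal_infty_less_eq(1) ereal_uminus_eq_reorder ereal_less_eq(1) uminus_ereal.simps(3))
    qed
  qed
qed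

end

section \<open>The site spaces\<close>

lemma adj_nth [simp]: "adj A $ i $ j = cnj (A $ j $ i)"
  by (simp add: adj_def map_matrix_def transpose_def)

lemma matrix2_eq_iff:
  fixes A B :: "'a^2^2"
  shows "A = B \<longleftrightarrow> A$1$1 = B$1$1 \<and> A$1$2 = B$1$2 \<and> A$2$1 = B$2$1 \<and> A$2$2 = B$2$2"
  by (auto simp: vec_eq_iff forall_2)

lemma matrix2_mult_nth: "((A :: complex^2^2) ** B) $ i $ j = A$i$1 * B$1$j + A$i$2 * B$2$j"
  by (simp add: matrix_matrix_mult_def sum_2)

lemma trace2: "trace (A :: complex^2^2) = A$1$1 + A$2$2"
  by (simp add: trace_def sum_2)

lemma adj_mult: "adj (A ** B) = adj B ** adj A"
  by (simp add: matrix2_eq_iff matrix2_mult_nth mult.commute)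

lemma adj_adj [simp]: "adj (adj A) = A"
  by (simp add: matrix2_eq_iff)

lemma psd_quadratic:
  assumes "psd A"
  shows "cnj x * A$1$1 * x + cnj x * A$1$2 * y + (cnj y * A$2$1 * x + cnj y * A$2$2 * y) \<in> \<real>\<^sub>\<ge>\<^sub>0"
  using assms[unfolded psd_def sum_2, rule_format, of "vector [x, y]"] by simp

text \<open>Positivity is tested on explicit vectors: \<open>(1, 0)\<close> and
  \<open>(0, 1)\<close> give the diagonal, \<open>(1, 1)\<close> and \<open>(1, \<i>)\<close> force
  the matrix to be Hermitian, and \<open>(b, - a)\<close> gives \<open>a\<close> times the
  determinant. The last test is void for \<open>a = 0\<close>, which is treated separately.\<close>

lemma density_matrix_entries:
  assumes "density_matrix \<rho>"
  obtains a b where "0 \<le> a" "a \<le> 1" "\<rho>$1$1 = complex_of_real a" "\<rho>$1$2 = b" "\<rho>$2$1 = cnj b"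
    "\<rho>$2$2 = complex_of_real (1 - a)" "(cmod b)\<^sup>2 \<le> a * (1 - a)"
proof -
  have Q: "cnj x * \<rho>$1$1 * x + cnj x * \<rho>$1$2 * y + (cnj y * \<rho>$2$1 * x + cnj y * \<rho>$2$2 * y) \<in> \<real>\<^sub>\<ge>\<^sub>0" for x y
    using assms by (simp add: density_matrix_def psd_quadratic)
  have tr: "\<rho>$1$1 + \<rho>$2$2 = 1" using assms by (simp add: density_matrix_def trace2)
  define a where "a = Re (\<rho>$1$1)"
  define b where "b = \<rho>$1$2"
  have 11: "\<rho>$1$1 = complex_of_real a" "0 \<le> a"
    using Q[of 1 0] by (auto simp: complex_nonneg_Reals_iff complex_eq_iff a_def)
  have 22: "\<rho>$2$2 = complex_of_real (1 - a)" using tr 11 by (simp add: algebra_simps)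
  have d: "0 \<le> 1 - a" using Q[of 0 1] 22 by (auto simp: complex_nonneg_Reals_iff)
  have 21: "\<rho>$2$1 = cnj b"
    using Q[of 1 1] Q[of 1 \<i>] 11 22 by (auto simp: complex_nonneg_Reals_iff complex_eq_iff b_def)
  have bb: "cnj b * b = complex_of_real ((cmod b)\<^sup>2)" by (simp add: complex_norm_square mult.commute flip: of_real_power)
  have "(cmod b)\<^sup>2 \<le> a * (1 - a)"
  proof (cases "a = 0")
    case True
    have "b = 0"
    proof (rule ccontr)
      assume b: "b \<noteq> 0"
      \<comment> \<open>With this scale the form at \<open>(t * b, - 1)\<close> takes the value
        \<open>-1\<close>, contradicting positivity.\<close>
      define t where "t = 1 / (cmod b)\<^sup>2"
      have "- (2 * t * (cmod b)\<^sup>2) + 1 \<ge> 0"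
      proof -
        have "cnj (of_real t * b) * \<rho>$1$1 * (of_real t * b) + cnj (of_real t * b) * \<rho>$1$2 * (- 1)
           + (cnj (- 1) * \<rho>$2$1 * (of_real t * b) + cnj (- 1) * \<rho>$2$2 * (- 1))
           = - (2 * of_real t * (cnj b * b)) + 1"
          using True by (simp add: 11 21 22 b_def algebra_simps)
        then show ?thesis using Q[of "of_real t * b" "- 1"] unfolding bb
          by (simp add: complex_nonneg_Reals_iff)
      qed
      then show False using b by (simp add: t_def)
    qed
    then show ?thesis using True by simp
  next
    case False
    have "cnj b * \<rho>$1$1 * b + cnj b * \<rho>$1$2 * (- of_real a)
      + (cnj (- of_real a) * \<rho>$2$1 * b + cnj (- of_real a) * \<rho>$2$2 * (- of_real a))
      = of_real a * (of_real (a * (1 - a)) - (cnj b * b))"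
      by (simp add: 11 21 22 b_def algebra_simps)
    then have "0 \<le> a * (a * (1 - a) - (cmod b)\<^sup>2)"
      using Q[of b "- of_real a"] unfolding bb by (simp add: complex_nonneg_Reals_iff)
    then show ?thesis using 11(2) False by (simp add: zero_le_mult_iff)
  qed
  then show ?thesis using 11 21 22 d b_def by (intro that) auto
qed

text \<open>Cholesky factorization: the displayed matrix is \<open>W ** adj W\<close> for the lower
  triangular \<open>W\<close> with rows \<open>(x, 0)\<close> and \<open>(y, z)\<close>. The choice
  \<open>0 \<le> x\<close> keeps \<open>1 + x\<close> invertible, as the reflection built from
  \<open>W\<close> requires.\<close>

lemma density_matrix_factor:
  assumes "density_matrix \<rho>"
  obtains x z :: real and y :: complex where "0 \<le> x" "x\<^sup>2 + (cmod y)\<^sup>2 + z\<^sup>2 = 1"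
    "\<rho> = vector [vector [of_real (x\<^sup>2), of_real x * cnj y], vector [of_real x * y, of_real ((cmod y)\<^sup>2 + z\<^sup>2)]]"
proof -
  obtain a b where ab: "0 \<le> a" "a \<le> 1" "\<rho>$1$1 = complex_of_real a" "\<rho>$1$2 = b" "\<rho>$2$1 = cnj b"
    "\<rho>$2$2 = complex_of_real (1 - a)" "(cmod b)\<^sup>2 \<le> a * (1 - a)"
    using density_matrix_entries[OF assms] .
  show ?thesis
  proof (cases "a = 0")
    case True
    then show ?thesis using ab by (intro that[of 0 0 1]) (simp_all add: matrix2_eq_iff)
  next
    case False
    define y where "y = cnj b / of_real (sqrt a)"
    have y2: "(cmod y)\<^sup>2 = (cmod b)\<^sup>2 / a" using ab by (simp add: y_def norm_divide power_divide)
    have "(cmod b)\<^sup>2 / a \<le> 1 - a" using ab False by (simp add: field_simps)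
    then have z: "(sqrt (1 - a - (cmod y)\<^sup>2))\<^sup>2 = 1 - a - (cmod y)\<^sup>2" by (simp add: y2)
    have xy: "of_real (sqrt a) * y = cnj b" using False ab by (simp add: y_def)
    have yx: "of_real (sqrt a) * cnj y = b" using arg_cong[OF xy, of cnj] by simp
    then show ?thesis using ab z xy yx
      by (intro that[of "sqrt a" y "sqrt (1 - a - (cmod y)\<^sup>2)"])
        (simp_all add: matrix2_eq_iff)
  qed
qed

text \<open>The last three elements complete a factor \<open>W\<close> of \<open>\<rho>\<close> to an orthonormal basis: they are the
  images of matrix units under the reflection that maps the first matrix unit to \<open>-W\<close>.\<close>

lemma site_basis_exists:
  assumes "density_matrix \<rho>"
  shows "\<exists>B :: 4 \<Rightarrow> complex^2^2. B 0 ** adj (B 0) = \<rho> \<and>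
     (\<forall>i j. trace (adj (B i) ** B j) = (if i = j then 1 else 0))"
proof -
  obtain x z :: real and y :: complex where xyz: "0 \<le> x" "x\<^sup>2 + (cmod y)\<^sup>2 + z\<^sup>2 = 1"
    "\<rho> = vector [vector [of_real (x\<^sup>2), of_real x * cnj y], vector [of_real x * y, of_real ((cmod y)\<^sup>2 + z\<^sup>2)]]"
    using density_matrix_factor[OF assms] .
  \<comment> \<open>\<open>K\<close> normalizes the reflection along \<open>w\<close>, the sum of
    the first matrix unit and \<open>W\<close>: the squared norm of \<open>w\<close> is
    \<open>2 * (1 + x)\<close>, and the reflection subtracts twice the projection onto
    \<open>w\<close>.\<close>
  define X Z K where "X = complex_of_real x" and "Z = complex_of_real z" and "K = complex_of_real (1 / (1 + x))"
  define yc where "yc = cnj y"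
  have real: "cnj X = X" "cnj Z = Z" "cnj K = K" "cnj yc = y" "cnj y = yc"
    by (simp_all add: X_def Z_def K_def yc_def)
  have n: "X * X + y * yc + Z * Z = 1"
  proof -
    have "complex_of_real (x\<^sup>2) + complex_of_real ((cmod y)\<^sup>2) + complex_of_real (z\<^sup>2) = 1"
      using arg_cong[OF xyz(2), of complex_of_real] by simp
    then show ?thesis unfolding complex_norm_square by (simp add: X_def Z_def yc_def power2_eq_square)
  qed
  have K: "K * (1 + X) = 1"
  proof -
    have "1 + complex_of_real x \<noteq> 0" using xyz(1) by (simp add: complex_eq_iff)
    then show ?thesis by (simp add: K_def X_def)
  qed
  define B :: "4 \<Rightarrow> complex^2^2" where "B = (\<lambda>i.
     if i = 1 then vector [vector [- yc, 0], vector [1 - y * yc * K, - (Z * yc * K)]]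
     else if i = 2 then vector [vector [- Z, 0], vector [- (y * Z * K), 1 - Z * Z * K]]
     else if i = 3 then vector [vector [0, 1], vector [0, 0]]
     else vector [vector [- X, 0], vector [- y, - Z]])"
  \<comment> \<open>The enumeration \<open>forall_4\<close> runs over 1 to 4, and in this type 4 is
    the distinguished index 0.\<close>
  have neq: "(1::4) \<noteq> 2" "(1::4) \<noteq> 3" "(2::4) \<noteq> 3" "(0::4) \<noteq> 1" "(0::4) \<noteq> 2" "(0::4) \<noteq> 3"
     "(4::4) = 0" "(1::4) \<noteq> 4" "(2::4) \<noteq> 4" "(3::4) \<noteq> 4"
    by simp_all
  have "B 0 ** adj (B 0) = \<rho>"
    unfolding xyz(3) B_def
    unfolding of_real_add complex_norm_square
    by (simp add: neq matrix2_eq_iff matrix2_mult_nth real X_def[symmetric] Z_def[symmetric] yc_def[symmetric] power2_eq_square)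
  moreover have "\<forall>i j. trace (adj (B i) ** B j) = (if i = j then 1 else 0)"
    unfolding forall_4 trace2 matrix2_mult_nth B_def adj_nth using n K
    apply (simp add: real neq)
    apply (intro conjI; algebra)
    done
  ultimately show ?thesis by blast
qed

lemma site_basis:
  assumes "density_matrix \<rho>"
  shows "site_basis \<rho> 0 ** adj (site_basis \<rho> 0) = \<rho>"
    and "trace (adj (site_basis \<rho> i) ** site_basis \<rho> j) = (if i = j then 1 else 0)"
  using someI_ex[OF site_basis_exists[OF assms]] unfolding site_basis_def[symmetric] by blast+

definition flatten :: "complex^2^2 \<Rightarrow> complex^4" where
  "flatten A = (\<chi> i. if i = 1 then A$1$1 else if i = 2 then A$1$2 else if i = 3 then A$2$1 else A$2$2)"

lemma trace_adj_flatten: "trace (adj P ** Q) = (\<Sum>a\<in>UNIV. cnj (flatten P $ a) * flatten Q $ a)"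
  by (simp add: flatten_def sum_4 trace2 matrix2_mult_nth)

text \<open>Orthonormality says \<open>V ** U = mat 1\<close> for the square matrix \<open>U\<close>
  whose columns are the flattened basis. A left inverse of a square matrix is a right inverse, and
  this gives completeness.\<close>

lemma orthonormal_parseval:
  fixes B :: "4 \<Rightarrow> complex^2^2"
  assumes "\<And>i j. trace (adj (B i) ** B j) = (if i = j then 1 else 0)"
  shows "(\<Sum>j\<in>UNIV. trace (adj P ** B j) * trace (adj (B j) ** Q)) = trace (adj P ** Q)"
proof -
  define U :: "complex^4^4" where "U = (\<chi> a j. flatten (B j) $ a)"
  define V :: "complex^4^4" where "V = (\<chi> j a. cnj (flatten (B j) $ a))"
  have "V ** U = mat 1"
    using assms[unfolded trace_adj_flatten] by (simp add: vec_eq_iff matrix_matrix_mult_def U_def V_def mat_def)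
  then have "U ** V = mat 1" using matrix_left_right_inverse by blast
  then have UV: "(\<Sum>j\<in>UNIV. flatten (B j) $ a * cnj (flatten (B j) $ b)) = (if a = b then 1 else 0)" for a b
    by (simp add: vec_eq_iff matrix_matrix_mult_def U_def V_def mat_def)
  have "(\<Sum>j\<in>UNIV. trace (adj P ** B j) * trace (adj (B j) ** Q))
    = (\<Sum>j\<in>UNIV. \<Sum>a\<in>UNIV. \<Sum>b\<in>UNIV. cnj (flatten P $ a) * flatten Q $ b * (flatten (B j) $ a * cnj (flatten (B j) $ b)))"
    unfolding trace_adj_flatten sum_product by (simp add: algebra_simps)
  also have "\<dots> = (\<Sum>a\<in>UNIV. \<Sum>j\<in>UNIV. \<Sum>b\<in>UNIV. cnj (flatten P $ a) * flatten Q $ b * (flatten (B j) $ a * cnj (flatten (B j) $ b)))"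
    by (rule sum.swap)
  also have "\<dots> = (\<Sum>a\<in>UNIV. \<Sum>b\<in>UNIV. cnj (flatten P $ a) * flatten Q $ b * (\<Sum>j\<in>UNIV. flatten (B j) $ a * cnj (flatten (B j) $ b)))"
    unfolding sum_distrib_left by (intro sum.cong refl sum.swap)
  also have "\<dots> = trace (adj P ** Q)"
    by (simp add: UV trace_adj_flatten if_distrib[of "(*) _"] cong: if_cong)
  finally show ?thesis .
qed

lemma site_coeff_mat1:
  "density_matrix \<rho> \<Longrightarrow> site_coeff \<rho> (mat 1) i j = (if i = j then 1 else 0)"
  by (simp add: site_coeff_def site_basis)

lemma site_coeff_mult:
  assumes "density_matrix \<rho>"
  shows "(\<Sum>j\<in>UNIV. site_coeff \<rho> A i j * site_coeff \<rho> C j l) = site_coeff \<rho> (A ** C) i l"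
  using orthonormal_parseval[OF site_basis(2)[OF assms], of "adj A ** site_basis \<rho> i" "C ** site_basis \<rho> l"]
  by (simp add: site_coeff_def adj_mult matrix_mul_assoc)

lemma site_coeff_00: "density_matrix \<rho> \<Longrightarrow> site_coeff \<rho> A 0 0 = trace (A ** \<rho>)"
  unfolding site_coeff_def
  by (subst trace_mul_sym) (metis matrix_mul_assoc site_basis(1) trace_mul_sym)

lemma site_coeff_add: "site_coeff \<rho> (A + C) i j = site_coeff \<rho> A i j + site_coeff \<rho> C i j"
  by (simp add: site_coeff_def trace2 matrix2_mult_nth algebra_simps)

lemma site_coeff_scaleR: "site_coeff \<rho> (c *\<^sub>R A) i j = of_real c * site_coeff \<rho> A i j"
  by (simp add: site_coeff_def trace2 matrix2_mult_nth) (simp add: scaleR_conv_of_real algebra_simps)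

section \<open>Site operators\<close>

lemma ell2_eqI: "(\<And>s. coord \<phi> s = coord \<psi> s) \<Longrightarrow> \<phi> = \<psi>"
  by (simp add: coord_inject[symmetric] fun_eq_iff)

lemma norm_ell2_power2: "(norm \<psi>)\<^sup>2 = (\<Sum>\<^sub>\<infinity>i. (cmod (coord \<psi> i))\<^sup>2)"
  unfolding power2_norm_eq_inner inner_ell2_def by (simp add: dot_square_norm)

lemma coord_scaleR: "coord (c *\<^sub>R \<psi>) s = complex_of_real c * coord \<psi> s"
  by (simp add: scaleR_ell2.rep_eq)

lemma coord_add: "coord (\<phi> + \<psi>) s = coord \<phi> s + coord \<psi> s"
  by (simp add: plus_ell2.rep_eq)

lemma coord_sum: "coord (\<Sum>i\<in>I. f i) s = (\<Sum>i\<in>I. coord (f i) s)"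
  by (induction I rule: infinite_finite_induct) (simp_all add: zero_ell2.rep_eq coord_add)

lemma scaleC_0: "scaleC c 0 = 0"
  by (rule ell2_eqI) (simp add: scaleC.rep_eq zero_ell2.rep_eq)

lemma scaleC_add: "scaleC c (\<phi> + \<psi>) = scaleC c \<phi> + scaleC c \<psi>"
  by (rule ell2_eqI) (simp add: scaleC.rep_eq coord_add algebra_simps)

lemma scaleC_scaleR: "scaleC c (a *\<^sub>R \<psi>) = a *\<^sub>R scaleC c \<psi>"
  by (rule ell2_eqI) (simp add: scaleC.rep_eq coord_scaleR algebra_simps)

lemma cinner_vacuum: "cinner vacuum \<psi> = coord \<psi> 0"
proof -
  have "cinner vacuum \<psi> = (\<Sum>\<^sub>\<infinity>s\<in>{0}. cnj (coord vacuum s) * coord \<psi> s)"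
    unfolding cinner_def by (rule infsum_cong_neutral) (auto simp: coord_vacuum)
  then show ?thesis by (simp add: coord_vacuum)
qed

lemma bounded_operators_id: "(\<lambda>\<psi>. \<psi>) \<in> bounded_operators"
  by (simp add: bounded_operators_def bounded_linear_ident)

lemma bounded_operators_comp:
  "S \<in> bounded_operators \<Longrightarrow> T \<in> bounded_operators \<Longrightarrow> (\<lambda>\<psi>. S (T \<psi>)) \<in> bounded_operators"
  by (auto simp: bounded_operators_def intro: bounded_linear_compose)

lemma bounded_operators_sum:
  assumes "\<And>i. i \<in> I \<Longrightarrow> T i \<in> bounded_operators"
  shows "(\<lambda>\<psi>. \<Sum>i\<in>I. c i *\<^sub>R T i \<psi>) \<in> bounded_operators"
  using assms
proof (induction I rule: infinite_finite_induct)
  case (insert i I)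
  then show ?case
    by (auto simp: bounded_operators_def scaleC_add scaleC_scaleR
        intro!: bounded_linear_add bounded_linear_const_scaleR)
qed (simp_all add: bounded_operators_def bounded_linear_zero scaleC_0)

lemma commutant_id: "(\<lambda>\<psi>. \<psi>) \<in> commutant \<A>"
  by (simp add: commutant_def bounded_operators_id fun_eq_iff)

lemma commutant_comp:
  "S \<in> commutant \<A> \<Longrightarrow> T \<in> commutant \<A> \<Longrightarrow> (\<lambda>\<psi>. S (T \<psi>)) \<in> commutant \<A>"
  by (auto simp: commutant_def bounded_operators_comp fun_eq_iff)

lemma commutant_sum:
  assumes \<A>: "\<A> \<subseteq> bounded_operators" and T: "\<And>i. i \<in> I \<Longrightarrow> T i \<in> commutant \<A>"
  shows "(\<lambda>\<psi>. \<Sum>i\<in>I. c i *\<^sub>R T i \<psi>) \<in> commutant \<A>"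
proof -
  have "(\<Sum>i\<in>I. c i *\<^sub>R T i (S \<psi>)) = S (\<Sum>i\<in>I. c i *\<^sub>R T i \<psi>)" if "S \<in> \<A>" for S \<psi>
  proof -
    have "linear S" using that \<A> by (auto simp: bounded_operators_def bounded_linear.linear)
    then show ?thesis using T that
      by (auto simp: linear_sum linear_scale commutant_def fun_eq_iff intro!: sum.cong)
  qed
  moreover have "(\<lambda>\<psi>. \<Sum>i\<in>I. c i *\<^sub>R T i \<psi>) \<in> bounded_operators"
    using T by (intro bounded_operators_sum) (auto simp: commutant_def)
  ultimately show ?thesis by (auto simp: commutant_def fun_eq_iff)
qed

lemma coord_site_op:
  "coord (site_op r k A \<psi>) s = (\<Sum>j\<in>UNIV.
     site_coeff (r k) A (Poly_Mapping.lookup s k) j * coord \<psi> (Poly_Mapping.update k j s))"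
  by (simp add: site_op.rep_eq)

lemma update_update_same: "Poly_Mapping.update k a (Poly_Mapping.update k b s) = Poly_Mapping.update k a s"
  by (rule poly_mapping_eqI) (simp add: Poly_Mapping.lookup_update)

lemma update_update_swap: "k \<noteq> l \<Longrightarrow>
    Poly_Mapping.update k a (Poly_Mapping.update l b s) = Poly_Mapping.update l b (Poly_Mapping.update k a s)"
  by (rule poly_mapping_eqI) (auto simp: Poly_Mapping.lookup_update)

lemma update_lookup: "Poly_Mapping.update k (Poly_Mapping.lookup s k) s = s"
  by (rule poly_mapping_eqI) (simp add: Poly_Mapping.lookup_update)

lemma site_op_mat1: "density_matrix (r k) \<Longrightarrow> site_op r k (mat 1) \<psi> = \<psi>"
  by (rule ell2_eqI) (simp add: coord_site_op site_coeff_mat1 update_lookup if_distrib[of "\<lambda>c. c * _"] cong: if_cong)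

lemma site_op_mult:
  assumes "density_matrix (r k)"
  shows "site_op r k A (site_op r k C \<psi>) = site_op r k (A ** C) \<psi>"
proof (rule ell2_eqI)
  fix s :: "nat \<Rightarrow>\<^sub>0 4"
  let ?l = "Poly_Mapping.lookup s k" and ?u = "\<lambda>j. Poly_Mapping.update k j s"
  have "coord (site_op r k A (site_op r k C \<psi>)) s
     = (\<Sum>j\<in>UNIV. \<Sum>i\<in>UNIV. site_coeff (r k) A ?l j * site_coeff (r k) C j i * coord \<psi> (?u i))"
    by (simp add: coord_site_op Poly_Mapping.lookup_update update_update_same sum_distrib_left mult.assoc)
  also have "\<dots> = (\<Sum>i\<in>UNIV. \<Sum>j\<in>UNIV. site_coeff (r k) A ?l j * site_coeff (r k) C j i * coord \<psi> (?u i))"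
    by (rule sum.swap)
  also have "\<dots> = coord (site_op r k (A ** C) \<psi>) s"
    by (simp add: coord_site_op site_coeff_mult[OF assms] flip: sum_distrib_right)
  finally show "coord (site_op r k A (site_op r k C \<psi>)) s = coord (site_op r k (A ** C) \<psi>) s" .
qed

lemma site_op_commute:
  assumes "k \<noteq> l"
  shows "site_op r k A (site_op r l C \<psi>) = site_op r l C (site_op r k A \<psi>)"
proof (rule ell2_eqI)
  fix s :: "nat \<Rightarrow>\<^sub>0 4"
  let ?k = "Poly_Mapping.lookup s k" and ?l = "Poly_Mapping.lookup s l"
    and ?u = "\<lambda>i j. Poly_Mapping.update l i (Poly_Mapping.update k j s)"
  have "coord (site_op r k A (site_op r l C \<psi>)) s
     = (\<Sum>j\<in>UNIV. \<Sum>i\<in>UNIV. site_coeff (r k) A ?k j * (site_coeff (r l) C ?l i * coord \<psi> (?u i j)))"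
    using assms by (simp add: coord_site_op Poly_Mapping.lookup_update sum_distrib_left)
  also have "\<dots> = (\<Sum>i\<in>UNIV. \<Sum>j\<in>UNIV. site_coeff (r k) A ?k j * (site_coeff (r l) C ?l i * coord \<psi> (?u i j)))"
    by (rule sum.swap)
  also have "\<dots> = coord (site_op r l C (site_op r k A \<psi>)) s"
    using assms by (simp add: coord_site_op Poly_Mapping.lookup_update sum_distrib_left update_update_swap[of k l] mult.left_commute)
  finally show "coord (site_op r k A (site_op r l C \<psi>)) s = coord (site_op r l C (site_op r k A \<psi>)) s" .
qed

lemma site_op_add_matrix: "site_op r k (A + C) \<psi> = site_op r k A \<psi> + site_op r k C \<psi>"
  by (rule ell2_eqI) (simp add: coord_site_op coord_add site_coeff_add sum.distrib algebra_simps)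

lemma site_op_scaleR_matrix: "site_op r k (c *\<^sub>R A) \<psi> = c *\<^sub>R site_op r k A \<psi>"
  by (rule ell2_eqI) (simp add: coord_site_op coord_scaleR site_coeff_scaleR sum_distrib_left algebra_simps)

lemma site_op_add: "site_op r k A (\<phi> + \<psi>) = site_op r k A \<phi> + site_op r k A \<psi>"
  by (rule ell2_eqI) (simp add: coord_site_op coord_add sum.distrib algebra_simps)

lemma site_op_scaleR: "site_op r k A (c *\<^sub>R \<psi>) = c *\<^sub>R site_op r k A \<psi>"
  by (rule ell2_eqI) (simp add: coord_site_op coord_scaleR sum_distrib_left algebra_simps)

lemma site_op_scaleC: "site_op r k A (scaleC c \<psi>) = scaleC c (site_op r k A \<psi>)"
  by (rule ell2_eqI) (simp add: coord_site_op scaleC.rep_eq sum_distrib_left algebra_simps)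

text \<open>Overwriting site \<open>k\<close> forgets only its old value, so the map is injective on
  each of the four sets where that value is fixed.\<close>

lemma sum_update_le:
  fixes g :: "(nat \<Rightarrow>\<^sub>0 4) \<Rightarrow> real"
  assumes g: "g summable_on UNIV" "\<And>s. 0 \<le> g s" and "finite F"
  shows "(\<Sum>s\<in>F. g (Poly_Mapping.update k j s)) \<le> 4 * infsum g UNIV"
proof -
  let ?u = "Poly_Mapping.update k j"
  let ?F = "\<lambda>i. {s\<in>F. Poly_Mapping.lookup s k = i}"
  have "(\<Sum>s\<in>F. g (?u s)) = (\<Sum>i\<in>UNIV. \<Sum>s\<in>?F i. g (?u s))"
    by (rule sum.group[symmetric]) (use assms in auto)
  also have "\<dots> \<le> (\<Sum>i\<in>(UNIV :: 4 set). infsum g UNIV)"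
  proof (rule sum_mono)
    fix i :: 4
    have "inj_on ?u (?F i)"
      by (rule inj_onI) (metis (mono_tags, lifting) mem_Collect_eq update_lookup update_update_same)
    then have "(\<Sum>s\<in>?F i. g (?u s)) = sum g (?u ` ?F i)" by (simp add: sum.reindex)
    also have "\<dots> \<le> infsum g UNIV"
      by (rule finite_sum_le_infsum) (use assms in auto)
    finally show "(\<Sum>s\<in>?F i. g (?u s)) \<le> infsum g UNIV" .
  qed
  finally show ?thesis by simp
qed

lemma site_op_bounded: "site_op r k A \<in> bounded_operators"
proof -
  define C where "C = (\<Sum>i\<in>UNIV. \<Sum>j\<in>UNIV. cmod (site_coeff (r k) A i j))"
  have C: "cmod (site_coeff (r k) A i j) \<le> C" for i j
  proof -
    have "cmod (site_coeff (r k) A i j) \<le> (\<Sum>j\<in>UNIV. cmod (site_coeff (r k) A i j))"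
      by (rule member_le_sum) auto
    also have "\<dots> \<le> C" unfolding C_def by (rule member_le_sum) (auto intro: sum_nonneg)
    finally show ?thesis .
  qed
  have C0: "0 \<le> C" using C[of 0 0] norm_ge_zero order_trans by blast
  \<comment> \<open>The 8 is the root of 64: a factor 4 from Cauchy-Schwarz over the four basis
    indices, 4 for the number of indices summed, and 4 from \<open>sum_update_le\<close>.\<close>
  have "norm (site_op r k A \<psi>) \<le> norm \<psi> * (8 * C)" for \<psi>
  proof (rule power2_le_imp_le)
    let ?g = "\<lambda>s. (cmod (coord \<psi> s))\<^sup>2"
    have "(norm (site_op r k A \<psi>))\<^sup>2 \<le> 4 * C\<^sup>2 * (16 * infsum ?g UNIV)"
      unfolding norm_ell2_power2
    proof (rule infsum_le_finite_sums[OF coord_summable])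
      fix F :: "(nat \<Rightarrow>\<^sub>0 4) set" assume F: "finite F" "F \<subseteq> UNIV"
      have "(cmod (coord (site_op r k A \<psi>) s))\<^sup>2 \<le> 4 * C\<^sup>2 * (\<Sum>j\<in>UNIV. ?g (Poly_Mapping.update k j s))" for s
      proof -
        have "cmod (coord (site_op r k A \<psi>) s) \<le> (\<Sum>j\<in>UNIV. C * cmod (coord \<psi> (Poly_Mapping.update k j s)))"
          unfolding coord_site_op
          by (rule order_trans[OF norm_sum sum_mono]) (simp add: norm_mult mult_right_mono C)
        then have "(cmod (coord (site_op r k A \<psi>) s))\<^sup>2 \<le> (\<Sum>j\<in>UNIV. C * cmod (coord \<psi> (Poly_Mapping.update k j s)))\<^sup>2"
          by (rule power_mono) simp
        also have "\<dots> \<le> (\<Sum>j\<in>UNIV. (C * cmod (coord \<psi> (Poly_Mapping.update k j s)))\<^sup>2) * real (card (UNIV :: 4 set))"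
          by (rule sum_squared_le_sum_of_squares)
        also have "\<dots> = 4 * C\<^sup>2 * (\<Sum>j\<in>UNIV. ?g (Poly_Mapping.update k j s))"
          by (simp add: power_mult_distrib flip: sum_distrib_left)
        finally show ?thesis .
      qed
      then have "(\<Sum>s\<in>F. (cmod (coord (site_op r k A \<psi>) s))\<^sup>2)
          \<le> (\<Sum>s\<in>F. 4 * C\<^sup>2 * (\<Sum>j\<in>UNIV. ?g (Poly_Mapping.update k j s)))"
        by (intro sum_mono)
      also have "\<dots> = 4 * C\<^sup>2 * (\<Sum>j\<in>UNIV. \<Sum>s\<in>F. ?g (Poly_Mapping.update k j s))"
        by (subst sum.swap) (simp add: sum_distrib_left)
      also have "\<dots> \<le> 4 * C\<^sup>2 * (\<Sum>j\<in>(UNIV :: 4 set). 4 * infsum ?g UNIV)"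
        by (intro mult_left_mono sum_mono sum_update_le coord_summable F) auto
      finally show "(\<Sum>s\<in>F. (cmod (coord (site_op r k A \<psi>) s))\<^sup>2) \<le> 4 * C\<^sup>2 * (16 * infsum ?g UNIV)"
        by simp
    qed
    then show "(norm (site_op r k A \<psi>))\<^sup>2 \<le> (norm \<psi> * (8 * C))\<^sup>2"
      by (simp add: power_mult_distrib norm_ell2_power2 algebra_simps)
  qed (use C0 in simp)
  then have "bounded_linear (site_op r k A)"
    by (intro bounded_linear_intro site_op_add site_op_scaleR)
  then show ?thesis by (simp add: bounded_operators_def site_op_scaleC)
qed

lemma site_op_in_tensor_algebra: "site_op r k A \<in> tensor_algebra r"
proof -
  have "site_op r k A \<circ> T = T \<circ> site_op r k A" if "T \<in> commutant {site_op r k A |k A. True}" for T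
  proof -
    have "T \<circ> site_op r k A = site_op r k A \<circ> T" using that unfolding commutant_def by blast
    then show ?thesis by simp
  qed
  then show ?thesis
    unfolding tensor_algebra_def using site_op_bounded by (subst commutant_def) blast
qed

lemma tensor_algebra_bounded: "tensor_algebra r \<subseteq> bounded_operators"
  by (auto simp: tensor_algebra_def commutant_def)

lemma tensor_algebra_sum:
  assumes "\<And>i. i \<in> I \<Longrightarrow> T i \<in> tensor_algebra r"
  shows "(\<lambda>\<psi>. \<Sum>i\<in>I. c i *\<^sub>R T i \<psi>) \<in> tensor_algebra r"
  using assms unfolding tensor_algebra_def
  by (intro commutant_sum) (auto simp: commutant_def)

section \<open>Elementary tensors and their vacuum expectations\<close>

primrec site_prod ::
  "(nat \<Rightarrow> complex^2^2) \<Rightarrow> (nat \<Rightarrow> complex^2^2) \<Rightarrow> nat \<Rightarrow> (nat \<Rightarrow>\<^sub>0 4) ell2 \<Rightarrow> (nat \<Rightarrow>\<^sub>0 4) ell2" where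
  "site_prod r a 0 = (\<lambda>\<psi>. \<psi>)"
| "site_prod r a (Suc n) = (\<lambda>\<psi>. site_op r n (a n) (site_prod r a n \<psi>))"

lemma site_prod_in_tensor_algebra: "site_prod r a n \<in> tensor_algebra r"
proof (induction n)
  case 0
  then show ?case by (simp add: tensor_algebra_def commutant_id)
next
  case (Suc n)
  then show ?case using site_op_in_tensor_algebra[of r n "a n"]
    by (simp add: tensor_algebra_def commutant_comp)
qed

lemma site_prod_cong: "(\<And>k. k < n \<Longrightarrow> a k = b k) \<Longrightarrow> site_prod r a n = site_prod r b n"
  by (induction n) simp_all

text \<open>The operator commutes past the factors at other sites until it meets \<open>a k\<close>,
  where the matrices multiply.\<close>

lemma site_op_site_prod:
  assumes "\<And>k. density_matrix (r k)" "A ** a k = c *\<^sub>R a k" "k < n"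
  shows "site_op r k A (site_prod r a n \<psi>) = c *\<^sub>R site_prod r a n \<psi>"
  using assms(3)
proof (induction n)
  case (Suc n)
  show ?case
  proof (cases "k = n")
    case True
    then have "A ** a n = c *\<^sub>R a n" using assms(2) by simp
    then show ?thesis using True by (simp add: site_op_mult assms(1) site_op_scaleR_matrix)
  next
    case False
    then show ?thesis using Suc by (simp add: site_op_commute[of k n] site_op_scaleR)
  qed
qed simp

text \<open>This expands the product over the sites of \<open>b True + b False\<close>, which is the
  identity; the induction separates the subsets by whether they contain the last site.\<close>

lemma sum_site_prod:
  assumes "\<And>k. density_matrix (r k)" "b True + b False = mat 1"
  shows "(\<Sum>U\<in>Pow {..<n}. site_prod r (\<lambda>k. b (k \<in> U)) n \<psi>) = \<psi>"
proof (induction n)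
  case (Suc n)
  let ?E = "\<lambda>n U. site_prod r (\<lambda>k. b (k \<in> U)) n \<psi>"
  have inj: "inj_on (insert n) (Pow {..<n})" by (auto simp: inj_on_def)
  have "(\<Sum>U\<in>Pow {..<Suc n}. ?E (Suc n) U)
     = (\<Sum>U\<in>Pow {..<n}. ?E (Suc n) U) + (\<Sum>U\<in>Pow {..<n}. ?E (Suc n) (insert n U))"
    unfolding lessThan_Suc Pow_insert
    by (subst sum.union_disjoint) (auto simp: sum.reindex[OF inj])
  also have "\<dots> = (\<Sum>U\<in>Pow {..<n}. ?E n U)"
    unfolding sum.distrib[symmetric]
  proof (rule sum.cong)
    fix U assume U: "U \<in> Pow {..<n}"
    then have n: "n \<notin> U" by auto
    have eq: "site_prod r (\<lambda>k. b (k \<in> insert n U)) n = site_prod r (\<lambda>k. b (k \<in> U)) n"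
      by (rule site_prod_cong) auto
    have "?E (Suc n) U + ?E (Suc n) (insert n U) = site_op r n (b True + b False) (?E n U)"
      unfolding site_prod.simps eq using n by (simp add: site_op_add_matrix)
    then show "?E (Suc n) U + ?E (Suc n) (insert n U) = ?E n U"
      by (simp add: assms site_op_mat1)
  qed simp
  finally show ?case using Suc by simp
qed simp

text \<open>Each factor acts on its own zeroth basis vector, so the coordinates factorize over the
  sites. At \<open>s = 0\<close> this is the independence of the sites under the product
  state.\<close>

lemma coord_site_prod_vacuum:
  "coord (site_prod r a n vacuum) s
    = (if \<forall>k\<ge>n. Poly_Mapping.lookup s k = 0
       then \<Prod>k<n. site_coeff (r k) (a k) (Poly_Mapping.lookup s k) 0 else 0)"
proof (induction n arbitrary: s)
  case 0
  have "s = 0 \<longleftrightarrow> (\<forall>k. Poly_Mapping.lookup s k = 0)" by (metis Poly_Mapping.lookup_zero poly_mapping_eqI)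
  then show ?case by (simp add: coord_vacuum)
next
  case (Suc n)
  have iff: "(\<forall>k\<ge>n. Poly_Mapping.lookup (Poly_Mapping.update n j s) k = 0)
      \<longleftrightarrow> j = 0 \<and> (\<forall>k\<ge>Suc n. Poly_Mapping.lookup s k = 0)" for j
    by (auto simp: Poly_Mapping.lookup_update Suc_le_eq)
  have "coord (site_prod r a (Suc n) vacuum) s = (\<Sum>j\<in>(UNIV :: 4 set). if j = 0 then
     (if \<forall>k\<ge>Suc n. Poly_Mapping.lookup s k = 0 then
       site_coeff (r n) (a n) (Poly_Mapping.lookup s n) 0 *
       (\<Prod>k<n. site_coeff (r k) (a k) (Poly_Mapping.lookup s k) 0) else 0) else 0)"
    unfolding site_prod.simps coord_site_op Suc iff
    by (rule sum.cong[OF refl]) (auto simp: Poly_Mapping.lookup_update)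
  then show ?case by (auto simp: mult.commute)
qed

lemma product_state_site_prod:
  assumes "\<And>k. density_matrix (r k)"
  shows "product_state (site_prod r a n) = (\<Prod>k<n. trace (a k ** r k))"
  by (simp add: product_state_def cinner_vacuum coord_site_prod_vacuum site_coeff_00 assms)

section \<open>Functional calculus for operators with finite spectrum\<close>

text \<open>Continuous steps between \<open>x\<close> and \<open>y > x\<close> compare the
  distribution functions at shifted points, and right continuity removes the shift. It supplies the
  uniqueness needed for \<open>law\<close>.\<close>

lemma real_measure_eqI:
  fixes M N :: "real measure"
  assumes M: "sets M = sets borel" "emeasure M (space M) = 1"
    and N: "sets N = sets borel" "emeasure N (space N) = 1"
    and eq: "\<And>f. continuous_on UNIV f \<Longrightarrow> bounded (range f) \<Longrightarrow> (\<integral>x. f x \<partial>M) = (\<integral>x. f x \<partial>N :: real)"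
  shows "M = N"
proof -
  have distr: "real_distribution K" if "sets K = sets borel" "emeasure K (space K) = 1" for K :: "real measure"
  proof -
    interpret prob_space K by (rule prob_spaceI) (rule that)
    show ?thesis using that sets_eq_imp_space_eq[OF that(1)]
      by (simp add: real_distribution_def real_distribution_axioms_def prob_space_axioms)
  qed
  interpret M: real_distribution M using distr M .
  interpret N: real_distribution N using distr N .
  have le: "cdf K x \<le> cdf L x"
    if "real_distribution K" "real_distribution L"
      and e: "\<And>f. continuous_on UNIV f \<Longrightarrow> bounded (range f) \<Longrightarrow> (\<integral>x. f x \<partial>K) = (\<integral>x. f x \<partial>L :: real)"
    for K L :: "real measure" and x
  proof -
    interpret K: real_distribution K by fact
    interpret L: real_distribution L by fact
    have "cdf K x \<le> cdf L y" if "x < y" for y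
    proof -
      have "continuous_on UNIV (cts_step x y)"
        using cts_step_uniformly_continuous[OF that] uniformly_continuous_imp_continuous by blast
      moreover have "bounded (range (cts_step x y))"
        by (rule boundedI[of _ 1]) (use that in \<open>auto simp: cts_step_def\<close>)
      ultimately show ?thesis
        using K.cdf_cts_step(1)[OF that] L.cdf_cts_step(2)[OF that] e by simp
    qed
    then have "\<forall>\<^sub>F y in at_right x. cdf K x \<le> cdf L y"
      by (auto simp: eventually_at_right_field intro: exI[of _ "x + 1"])
    moreover have "(cdf L \<longlongrightarrow> cdf L x) (at_right x)"
      using L.cdf_is_right_cont by (simp add: continuous_within)
    ultimately show ?thesis
      by (intro tendsto_lowerbound) auto
  qed
  have "cdf M = cdf N"
    using le[of M N] le[of N M] eq M.real_distribution_axioms N.real_distribution_axioms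
    by (intro ext antisym) simp_all
  then show ?thesis
    using cdf_unique M.real_distribution_axioms N.real_distribution_axioms by blast
qed

lemma finite_support_measure:
  fixes w ev :: "'i \<Rightarrow> real"
  assumes I: "finite I" and w: "\<forall>i\<in>I. 0 \<le> w i" "(\<Sum>i\<in>I. w i) = 1"
  defines "\<mu> \<equiv> distr (point_measure I (\<lambda>i. ennreal (w i))) borel ev"
  shows "sets \<mu> = sets borel" "emeasure \<mu> (space \<mu>) = 1"
    and "\<And>f :: real \<Rightarrow> real. continuous_on UNIV f \<Longrightarrow> (\<integral>x. f x \<partial>\<mu>) = (\<Sum>i\<in>I. w i * f (ev i))"
    and "\<And>B. B \<in> sets borel \<Longrightarrow> measure \<mu> B = (\<Sum>i | i \<in> I \<and> ev i \<in> B. w i)"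
proof -
  show "sets \<mu> = sets borel" by (simp add: \<mu>_def)
  have em: "emeasure \<mu> B = ennreal (\<Sum>i | i \<in> I \<and> ev i \<in> B. w i)" if "B \<in> sets borel" for B
  proof -
    have "emeasure \<mu> B = emeasure (point_measure I (\<lambda>i. ennreal (w i))) {i \<in> I. ev i \<in> B}"
      unfolding \<mu>_def using that
      by (subst emeasure_distr) (auto simp: space_point_measure intro!: arg_cong[where f = "emeasure _"])
    also have "\<dots> = (\<Sum>i | i \<in> I \<and> ev i \<in> B. ennreal (w i))"
      using I by (intro emeasure_point_measure_finite) auto
    also have "\<dots> = ennreal (\<Sum>i | i \<in> I \<and> ev i \<in> B. w i)"
      using w by (intro sum_ennreal) auto
    finally show ?thesis .
  qed
  show "emeasure \<mu> (space \<mu>) = 1"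
    using em[of UNIV] w by (simp add: \<mu>_def)
  show "measure \<mu> B = (\<Sum>i | i \<in> I \<and> ev i \<in> B. w i)" if "B \<in> sets borel" for B
    unfolding measure_def em[OF that] using w by (intro enn2real_ennreal sum_nonneg) auto
  show "(\<integral>x. f x \<partial>\<mu>) = (\<Sum>i\<in>I. w i * f (ev i))" if "continuous_on UNIV f" for f :: "real \<Rightarrow> real"
    unfolding \<mu>_def using that I w
    by (subst integral_distr) (auto simp: lebesgue_integral_point_measure_finite intro: borel_measurable_continuous_onI)
qed

text \<open>The values \<open>ev i\<close> may coincide and single \<open>E i\<close> may vanish, so
  configurations \<open>U\<close> with the same mean can be kept apart as separate indices.\<close>

locale finite_spectral_resolution =
  fixes S :: "'h::real_normed_vector \<Rightarrow> 'h" and I :: "'i set" and E :: "'i \<Rightarrow> 'h \<Rightarrow> 'h" and ev :: "'i \<Rightarrow> real"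
  assumes finite: "finite I" and bounded: "bounded_linear S" and E_bounded: "i \<in> I \<Longrightarrow> bounded_linear (E i)"
    and eigen: "i \<in> I \<Longrightarrow> S (E i \<psi>) = ev i *\<^sub>R E i \<psi>"
    and resolution: "(\<Sum>i\<in>I. E i \<psi>) = \<psi>"
begin

lemma funpow_eigen: "i \<in> I \<Longrightarrow> (S ^^ m) (E i \<psi>) = ev i ^ m *\<^sub>R E i \<psi>"
  by (induction m) (simp_all add: eigen linear_scale[OF bounded_linear.linear[OF bounded]])

lemma funpow_resolution: "(S ^^ m) \<psi> = (\<Sum>i\<in>I. ev i ^ m *\<^sub>R E i \<psi>)"
proof -
  have "linear (S ^^ m)"
    by (induction m) (auto simp: linear_iff linear_add[OF bounded_linear.linear[OF bounded]]
        linear_scale[OF bounded_linear.linear[OF bounded]])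
  then have "(S ^^ m) (\<Sum>i\<in>I. E i \<psi>) = (\<Sum>i\<in>I. (S ^^ m) (E i \<psi>))" by (rule linear_sum)
  then show ?thesis by (simp add: resolution funpow_eigen)
qed

lemma poly_op_eq: "poly_op p S \<psi> = (\<Sum>i\<in>I. poly p (ev i) *\<^sub>R E i \<psi>)"
proof -
  have "poly_op p S \<psi> = (\<Sum>m\<le>degree p. \<Sum>i\<in>I. (coeff p m * ev i ^ m) *\<^sub>R E i \<psi>)"
    by (simp add: poly_op_def funpow_resolution scaleR_sum_right)
  also have "\<dots> = (\<Sum>i\<in>I. \<Sum>m\<le>degree p. (coeff p m * ev i ^ m) *\<^sub>R E i \<psi>)"
    by (rule sum.swap)
  finally show ?thesis by (simp add: poly_altdef scaleR_sum_left)
qed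

lemma eigenvalue_bound:
  assumes "i \<in> I" "E i \<psi> \<noteq> 0"
  shows "ev i \<in> {- onorm S..onorm S}"
proof -
  have "norm (S (E i \<psi>)) \<le> onorm S * norm (E i \<psi>)" by (rule onorm[OF bounded])
  then have "\<bar>ev i\<bar> * norm (E i \<psi>) \<le> onorm S * norm (E i \<psi>)" using assms by (simp add: eigen)
  then show ?thesis using assms(2) by (simp add: abs_le_iff)
qed

lemma poly_op_tendsto:
  assumes p: "uniform_limit {- onorm S..onorm S} (\<lambda>m. poly (p m)) f sequentially"
  shows "(\<lambda>m. poly_op (p m) S \<psi>) \<longlonglongrightarrow> (\<Sum>i\<in>I. f (ev i) *\<^sub>R E i \<psi>)"
    and "(\<lambda>m. onorm (\<lambda>\<psi>. poly_op (p m) S \<psi> - (\<Sum>i\<in>I. f (ev i) *\<^sub>R E i \<psi>))) \<longlonglongrightarrow> 0"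
proof -
  have lim: "(\<lambda>m. poly (p m) (ev i)) \<longlonglongrightarrow> f (ev i)" if "i \<in> I" "E i \<psi> \<noteq> 0" for i \<psi>
    using tendsto_uniform_limitI[OF p eigenvalue_bound[OF that]] .
  show "(\<lambda>m. poly_op (p m) S \<psi>) \<longlonglongrightarrow> (\<Sum>i\<in>I. f (ev i) *\<^sub>R E i \<psi>)"
    unfolding poly_op_eq
  proof (rule tendsto_sum)
    fix i assume "i \<in> I"
    then show "(\<lambda>m. poly (p m) (ev i) *\<^sub>R E i \<psi>) \<longlonglongrightarrow> f (ev i) *\<^sub>R E i \<psi>"
      \<comment> \<open>Convergence at \<open>ev i\<close> is known only if \<open>E i\<close> has a
        non-zero value, which places \<open>ev i\<close> within the norm bound; otherwise the
        summand is 0.\<close>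
      using lim[of i \<psi>] by (cases "E i \<psi> = 0") (auto intro: tendsto_intros)
  qed
  show "(\<lambda>m. onorm (\<lambda>\<psi>. poly_op (p m) S \<psi> - (\<Sum>i\<in>I. f (ev i) *\<^sub>R E i \<psi>))) \<longlonglongrightarrow> 0"
  proof (rule tendsto_sandwich[where f = "\<lambda>_. 0" and h = "\<lambda>m. \<Sum>i\<in>I. \<bar>poly (p m) (ev i) - f (ev i)\<bar> * onorm (E i)"])
    have bl: "bounded_linear (\<lambda>\<psi>. (poly (p m) (ev i) - f (ev i)) *\<^sub>R E i \<psi>)" if "i \<in> I" for i m
      using E_bounded[OF that] by (rule bounded_linear_const_scaleR)
    have eq: "(\<lambda>\<psi>. poly_op (p m) S \<psi> - (\<Sum>i\<in>I. f (ev i) *\<^sub>R E i \<psi>))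
       = (\<lambda>\<psi>. \<Sum>i\<in>I. (poly (p m) (ev i) - f (ev i)) *\<^sub>R E i \<psi>)" for m
      by (simp add: poly_op_eq sum_subtractf scaleR_diff_left)
    show "\<forall>\<^sub>F m in sequentially. 0 \<le> onorm (\<lambda>\<psi>. poly_op (p m) S \<psi> - (\<Sum>i\<in>I. f (ev i) *\<^sub>R E i \<psi>))"
      unfolding eq by (intro always_eventually allI onorm_pos_le bounded_linear_sum bl)
    show "\<forall>\<^sub>F m in sequentially. onorm (\<lambda>\<psi>. poly_op (p m) S \<psi> - (\<Sum>i\<in>I. f (ev i) *\<^sub>R E i \<psi>))
        \<le> (\<Sum>i\<in>I. \<bar>poly (p m) (ev i) - f (ev i)\<bar> * onorm (E i))"
    proof (intro always_eventually allI)
      fix m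
      have "onorm (\<lambda>\<psi>. \<Sum>i\<in>I. (poly (p m) (ev i) - f (ev i)) *\<^sub>R E i \<psi>)
         \<le> (\<Sum>i\<in>I. onorm (\<lambda>\<psi>. (poly (p m) (ev i) - f (ev i)) *\<^sub>R E i \<psi>))"
        by (rule onorm_sum[OF finite bl])
      also have "\<dots> = (\<Sum>i\<in>I. \<bar>poly (p m) (ev i) - f (ev i)\<bar> * onorm (E i))"
        by (intro sum.cong refl onorm_scaleR E_bounded)
      finally show "onorm (\<lambda>\<psi>. poly_op (p m) S \<psi> - (\<Sum>i\<in>I. f (ev i) *\<^sub>R E i \<psi>))
        \<le> (\<Sum>i\<in>I. \<bar>poly (p m) (ev i) - f (ev i)\<bar> * onorm (E i))" unfolding eq .
    qed
    have "(\<lambda>m. \<bar>poly (p m) (ev i) - f (ev i)\<bar> * onorm (E i)) \<longlonglongrightarrow> 0" if "i \<in> I" for i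
    proof (cases "E i = (\<lambda>_. 0)")
      case True
      then show ?thesis by (simp add: onorm_zero)
    next
      case False
      then obtain \<psi> where "E i \<psi> \<noteq> 0" by (auto simp: fun_eq_iff)
      then have "(\<lambda>m. \<bar>poly (p m) (ev i) - f (ev i)\<bar> * onorm (E i)) \<longlonglongrightarrow> \<bar>f (ev i) - f (ev i)\<bar> * onorm (E i)"
        by (intro tendsto_intros lim[OF that])
      then show ?thesis by simp
    qed
    then show "(\<lambda>m. \<Sum>i\<in>I. \<bar>poly (p m) (ev i) - f (ev i)\<bar> * onorm (E i)) \<longlonglongrightarrow> 0"
      by (rule tendsto_null_sum)
  qed simp
qed

text \<open>Weierstrass approximation on the norm interval gives existence. For uniqueness,
  convergence in operator norm implies pointwise convergence, and along any admissible polynomials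
  the pointwise limit is the same sum.\<close>

lemma fun_calc_eq:
  assumes M: "\<And>T. T \<in> \<M> \<Longrightarrow> bounded_linear T" and f: "continuous_on UNIV f"
    and T: "(\<lambda>\<psi>. \<Sum>i\<in>I. f (ev i) *\<^sub>R E i \<psi>) \<in> \<M>"
  shows "fun_calc \<M> f S = (\<lambda>\<psi>. \<Sum>i\<in>I. f (ev i) *\<^sub>R E i \<psi>)"
  unfolding fun_calc_def
proof (rule the_equality)
  let ?K = "{- onorm S..onorm S}"
  have "\<exists>p. \<forall>x\<in>?K. \<bar>f x - poly p x\<bar> < 1 / real (Suc m)" for m
  proof -
    obtain g where g: "real_polynomial_function g" "\<And>x. x \<in> ?K \<Longrightarrow> \<bar>f x - g x\<bar> < 1 / real (Suc m)"
      using Stone_Weierstrass_real_polynomial_function[of ?K f "1 / real (Suc m)"] f continuous_on_subset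
      by (metis compact_Icc of_nat_0_less_iff subset_UNIV zero_less_Suc zero_less_divide_1_iff)
    obtain a n where "g = (\<lambda>x. \<Sum>i\<le>n. a i * x ^ i)"
      using g(1) unfolding real_polynomial_function_iff_sum by blast
    then have "g = poly (\<Sum>i\<le>n. monom (a i) i)" by (simp add: fun_eq_iff poly_sum poly_monom)
    then show ?thesis using g(2) by blast
  qed
  then obtain p where p: "\<And>m x. x \<in> ?K \<Longrightarrow> \<bar>f x - poly (p m) x\<bar> < 1 / real (Suc m)" by metis
  have "uniform_limit ?K (\<lambda>m. poly (p m)) f sequentially"
  proof (rule uniform_limitI)
    fix e :: real assume "e > 0"
    have "(\<lambda>m. 1 / real (Suc m)) \<longlonglongrightarrow> 0" using LIMSEQ_inverse_real_of_nat by (simp add: inverse_eq_divide)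
    then have "\<forall>\<^sub>F m in sequentially. 1 / real (Suc m) < e" using \<open>e > 0\<close> by (rule order_tendstoD)
    then show "\<forall>\<^sub>F m in sequentially. \<forall>x\<in>?K. dist (poly (p m) x) (f x) < e"
      by eventually_elim (use p in \<open>fastforce simp: dist_real_def abs_minus_commute intro: less_trans\<close>)
  qed
  then show "(\<lambda>\<psi>. \<Sum>i\<in>I. f (ev i) *\<^sub>R E i \<psi>) \<in> \<M> \<and> (\<exists>p. uniform_limit ?K (\<lambda>m. poly (p m)) f sequentially
      \<and> (\<lambda>m. onorm (\<lambda>\<psi>. poly_op (p m) S \<psi> - (\<Sum>i\<in>I. f (ev i) *\<^sub>R E i \<psi>))) \<longlonglongrightarrow> 0)"
    using T poly_op_tendsto(2) by blast
next
  fix T assume "T \<in> \<M> \<and> (\<exists>p. uniform_limit {- onorm S..onorm S} (\<lambda>m. poly (p m)) f sequentially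
      \<and> (\<lambda>m. onorm (\<lambda>\<psi>. poly_op (p m) S \<psi> - T \<psi>)) \<longlonglongrightarrow> 0)"
  then obtain p where T: "bounded_linear T" and p: "uniform_limit {- onorm S..onorm S} (\<lambda>m. poly (p m)) f sequentially"
    and lim: "(\<lambda>m. onorm (\<lambda>\<psi>. poly_op (p m) S \<psi> - T \<psi>)) \<longlonglongrightarrow> 0"
    using M by blast
  show "T = (\<lambda>\<psi>. \<Sum>i\<in>I. f (ev i) *\<^sub>R E i \<psi>)"
  proof
    fix \<psi>
    have bl: "bounded_linear (\<lambda>\<psi>. poly_op q S \<psi> - T \<psi>)" for q
      unfolding poly_op_eq
      by (intro bounded_linear_sub bounded_linear_sum bounded_linear_const_scaleR E_bounded T)
    have "(\<lambda>m. poly_op (p m) S \<psi> - T \<psi>) \<longlonglongrightarrow> 0"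
    proof (rule Lim_null_comparison)
      show "\<forall>\<^sub>F m in sequentially. norm (poly_op (p m) S \<psi> - T \<psi>) \<le> onorm (\<lambda>\<psi>. poly_op (p m) S \<psi> - T \<psi>) * norm \<psi>"
        using onorm[OF bl] by simp
      show "(\<lambda>m. onorm (\<lambda>\<psi>. poly_op (p m) S \<psi> - T \<psi>) * norm \<psi>) \<longlonglongrightarrow> 0"
        using tendsto_mult_right[OF lim, of "norm \<psi>"] by simp
    qed
    then have "(\<lambda>m. poly_op (p m) S \<psi>) \<longlonglongrightarrow> T \<psi>" by (simp add: LIM_zero_iff)
    then show "T \<psi> = (\<Sum>i\<in>I. f (ev i) *\<^sub>R E i \<psi>)"
      using poly_op_tendsto(1)[OF p] LIMSEQ_unique by blast
  qed
qed

text \<open>The candidate is the discrete measure with mass \<open>w i\<close> at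
  \<open>ev i\<close>, where \<open>w i\<close> is the value of the state on \<open>E i\<close>;
  coinciding eigenvalues merge under the push-forward.\<close>

lemma measure_law:
  assumes M: "\<And>T. T \<in> \<M> \<Longrightarrow> bounded_linear T"
    and T: "\<And>c. (\<lambda>\<psi>. \<Sum>i\<in>I. c i *\<^sub>R E i \<psi>) \<in> \<M>"
    and \<omega>: "\<And>c. \<omega> (\<lambda>\<psi>. \<Sum>i\<in>I. c i *\<^sub>R E i \<psi>) = complex_of_real (\<Sum>i\<in>I. c i * w i)"
    and w: "\<forall>i\<in>I. 0 \<le> w i" "(\<Sum>i\<in>I. w i) = 1" and B: "B \<in> sets borel"
  shows "measure (law \<M> \<omega> S) B = (\<Sum>i | i \<in> I \<and> ev i \<in> B. w i)"
proof -
  define \<mu> where "\<mu> = distr (point_measure I (\<lambda>i. ennreal (w i))) borel ev"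
  note \<mu> = finite_support_measure[OF finite w, where ev = ev, folded \<mu>_def]
  have int: "complex_of_real (\<integral>x. f x \<partial>\<mu>) = \<omega> (fun_calc \<M> f S)" if "continuous_on UNIV f" for f
    using \<mu>(3)[OF that] fun_calc_eq[OF M that T] by (simp add: \<omega> mult.commute)
  have "law \<M> \<omega> S = \<mu>"
    unfolding law_def
  proof (rule the_equality)
    show "sets \<mu> = sets borel \<and> emeasure \<mu> (space \<mu>) = 1 \<and>
     (\<forall>f. continuous_on UNIV f \<and> bounded (range f) \<longrightarrow> complex_of_real (\<integral>x. f x \<partial>\<mu>) = \<omega> (fun_calc \<M> f S))"
      using \<mu>(1,2) int by blast
  next
    fix \<mu>' :: "real measure"
    assume *: "sets \<mu>' = sets borel \<and> emeasure \<mu>' (space \<mu>') = 1 \<and>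
     (\<forall>f. continuous_on UNIV f \<and> bounded (range f) \<longrightarrow> complex_of_real (\<integral>x. f x \<partial>\<mu>') = \<omega> (fun_calc \<M> f S))"
    show "\<mu>' = \<mu>"
    proof (rule real_measure_eqI)
      fix f :: "real \<Rightarrow> real" assume f: "continuous_on UNIV f" "bounded (range f)"
      then have "complex_of_real (\<integral>x. f x \<partial>\<mu>') = complex_of_real (\<integral>x. f x \<partial>\<mu>)" using * int by simp
      then show "(\<integral>x. f x \<partial>\<mu>') = (\<integral>x. f x \<partial>\<mu>)" by (simp only: of_real_eq_iff)
    qed (use * \<mu>(1,2) in auto)
  qed
  then show ?thesis using \<mu>(4)[OF B] by simp
qed

end

section \<open>Spin observables\<close>

definition spin_matrix :: "real^3 \<Rightarrow> complex^2^2" where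
  "spin_matrix \<nu> = \<nu>$1 *\<^sub>R sigma_x + \<nu>$2 *\<^sub>R sigma_y + \<nu>$3 *\<^sub>R sigma_z"

definition spin_proj :: "real^3 \<Rightarrow> bool \<Rightarrow> complex^2^2" where
  "spin_proj \<nu> b = (1/2) *\<^sub>R (mat 1 + ((if b then 1 else - 1) / norm \<nu>) *\<^sub>R spin_matrix \<nu>)"

text \<open>The Bloch vector, that is, the expectations of the three Pauli matrices when the
  argument is a density matrix; for the limit state it is \<open>v\<close>.\<close>

definition bloch :: "complex^2^2 \<Rightarrow> real^3" where
  "bloch \<rho> = vector [2 * Re (\<rho>$1$2), - 2 * Im (\<rho>$1$2), 2 * Re (\<rho>$1$1) - 1]"

lemma spin_matrix_entries:
  "spin_matrix \<nu> $1$1 = of_real (\<nu>$3)" "spin_matrix \<nu> $1$2 = Complex (\<nu>$1) (- \<nu>$2)"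
  "spin_matrix \<nu> $2$1 = Complex (\<nu>$1) (\<nu>$2)" "spin_matrix \<nu> $2$2 = - of_real (\<nu>$3)"
  by (simp_all add: spin_matrix_def sigma_x_def sigma_y_def sigma_z_def complex_eq_iff)

lemma norm_power2_3: "(norm (\<nu> :: real^3))\<^sup>2 = (\<nu>$1)\<^sup>2 + (\<nu>$2)\<^sup>2 + (\<nu>$3)\<^sup>2"
  unfolding power2_norm_eq_inner by (simp add: inner_vec_def sum_3 power2_eq_square)

lemma matrix_scaleR_mult:
  fixes A B :: "complex^2^2"
  shows "A ** (c *\<^sub>R B) = c *\<^sub>R (A ** B)" "(c *\<^sub>R A) ** B = c *\<^sub>R (A ** B)"
  by (simp_all add: matrix2_eq_iff matrix2_mult_nth scaleR_add_right)

text \<open>Distinct Pauli matrices anticommute and each squares to the identity, so the cross terms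
  cancel. Hence the eigenvalues can only be plus or minus \<open>norm \<nu>\<close>.\<close>

lemma spin_matrix_square: "spin_matrix \<nu> ** spin_matrix \<nu> = (norm \<nu>)\<^sup>2 *\<^sub>R mat 1"
  unfolding norm_power2_3
  by (simp add: matrix2_eq_iff matrix2_mult_nth spin_matrix_entries mat_def
      complex_eq_iff power2_eq_square algebra_simps)

lemma spin_matrix_proj:
  assumes "\<nu> \<noteq> 0"
  shows "spin_matrix \<nu> ** spin_proj \<nu> b = (if b then norm \<nu> else - norm \<nu>) *\<^sub>R spin_proj \<nu> b"
  using assms unfolding spin_proj_def matrix_scaleR_mult matrix_add_ldistrib spin_matrix_square
  by (simp add: scaleR_add_right power2_eq_square algebra_simps)

lemma spin_proj_sum: "spin_proj \<nu> True + spin_proj \<nu> False = mat 1"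
  by (simp add: spin_proj_def algebra_simps flip: scaleR_add_left)

lemma inner_bloch:
  "\<nu> \<bullet> bloch \<rho> = \<nu>$1 * (2 * Re (\<rho>$1$2)) + \<nu>$2 * (- 2 * Im (\<rho>$1$2)) + \<nu>$3 * (2 * Re (\<rho>$1$1) - 1)"
  by (simp add: inner_vec_def sum_3 bloch_def)

lemma trace_spin_proj:
  assumes "density_matrix \<rho>"
  shows "trace (spin_proj \<nu> b ** \<rho>)
    = complex_of_real (if b then (1 + \<nu> \<bullet> bloch \<rho> / norm \<nu>) / 2 else 1 - (1 + \<nu> \<bullet> bloch \<rho> / norm \<nu>) / 2)"
proof -
  obtain a c where \<rho>: "\<rho>$1$1 = complex_of_real a" "\<rho>$1$2 = c" "\<rho>$2$1 = cnj c" "\<rho>$2$2 = complex_of_real (1 - a)"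
    using density_matrix_entries[OF assms] by metis
  show ?thesis
    unfolding inner_bloch
    by (simp add: trace2 matrix2_mult_nth spin_proj_def spin_matrix_entries \<rho> mat_def complex_eq_iff
        add_divide_distrib diff_divide_distrib algebra_simps)
qed

text \<open>The Bloch vector lies in the unit ball, because 1 minus its squared norm is four times
  the determinant. For the site states this puts the parameters into \<open>{0..1}\<close>; for the
  limit state it is \<open>mean_bound\<close>.\<close>

lemma inner_bloch_bound:
  assumes "density_matrix \<rho>"
  shows "\<bar>\<nu> \<bullet> bloch \<rho>\<bar> \<le> norm \<nu>"
proof -
  obtain a c where \<rho>: "\<rho>$1$1 = complex_of_real a" "\<rho>$1$2 = c" "(cmod c)\<^sup>2 \<le> a * (1 - a)"
    using density_matrix_entries[OF assms] by metis
  have "(norm (bloch \<rho>))\<^sup>2 = 4 * (cmod c)\<^sup>2 + (2 * a - 1)\<^sup>2"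
    by (simp add: norm_power2_3 bloch_def \<rho> cmod_power2 power_mult_distrib)
  also have "\<dots> \<le> 1\<^sup>2" using \<rho>(3) by (simp add: power2_eq_square algebra_simps)
  finally have "norm (bloch \<rho>) \<le> 1" by (rule power2_le_imp_le) simp
  then have "norm \<nu> * norm (bloch \<rho>) \<le> norm \<nu>" by (simp add: mult_left_le)
  then show ?thesis using Cauchy_Schwarz_ineq2[of \<nu> "bloch \<rho>"] by simp
qed

section \<open>States along the orbit of the channel and the laws of the spin means\<close>

lemma completely_positive_psd:
  assumes "completely_positive \<Phi>" "psd A"
  shows "psd (\<Phi> A)"
proof -
  have iff: "block_psd 1 (\<lambda>_ _. B) \<longleftrightarrow> psd B" for B
  proof -
    have "(\<forall>x :: nat \<Rightarrow> complex^2. P (x 0)) \<longleftrightarrow> (\<forall>x. P x)" for P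
      by (auto dest: spec[of _ "\<lambda>_. _"])
    then show ?thesis by (simp add: block_psd_def psd_def lessThan_Suc)
  qed
  have "block_psd 1 (\<lambda>_ _. A) \<longrightarrow> block_psd 1 (\<lambda>_ _. \<Phi> A)"
    using assms(1) unfolding completely_positive_def by blast
  then show ?thesis using assms(2) iff by blast
qed

lemma density_matrix_iterate:
  assumes "completely_positive \<Phi>" "trace_preserving \<Phi>" "density_matrix \<rho>"
  shows "density_matrix ((\<Phi> ^^ k) \<rho>)"
  by (induction k) (use assms in \<open>auto simp: density_matrix_def trace_preserving_def completely_positive_psd\<close>)

lemma spin_mean_eq: "spin_mean r \<nu> n \<psi> = (1 / real n) *\<^sub>R (\<Sum>k<n. site_op r k (spin_matrix \<nu>) \<psi>)"
  by (simp add: spin_mean_def partial_sum_def spin_matrix_def site_op_add_matrix site_op_scaleR_matrix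
      sum.distrib scaleR_sum_right)

lemma sum_spins:
  assumes "U \<subseteq> {..<n}"
  shows "(\<Sum>k<n. if k \<in> U then a else - a) = a * (2 * real (card U) - real n)"
proof -
  have fin: "finite U" using assms finite_subset by blast
  have le: "card U \<le> n" using card_mono[OF _ assms] by simp
  have "{..<n} \<inter> U = U" "{..<n} \<inter> - U = {..<n} - U" using assms by auto
  then have "(\<Sum>k<n. if k \<in> U then a else - a) = real (card U) * a - real (card ({..<n} - U)) * a"
    by (simp add: sum.If_cases)
  also have "card ({..<n} - U) = n - card U" using assms fin by (simp add: card_Diff_subset)
  finally show ?thesis using le by (simp add: of_nat_diff algebra_simps)
qed

lemma product_state_sum:
  "product_state (\<lambda>\<psi>. \<Sum>i\<in>I. c i *\<^sub>R T i \<psi>) = (\<Sum>i\<in>I. complex_of_real (c i) * product_state (T i))"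
  by (simp add: product_state_def cinner_vacuum coord_sum coord_scaleR)

text \<open>Here the operator problem becomes the two-valued one: \<open>U\<close> labels the
  product of projections onto \<open>+norm \<nu>\<close> at the sites of \<open>U\<close> and onto
  \<open>-norm \<nu>\<close> at the others, and the product state gives it the weight
  \<open>bern p n U\<close>.\<close>

lemma measure_law_spin_mean:
  assumes r: "\<And>k. density_matrix (r k)" and \<nu>: "\<nu> \<noteq> 0" and n: "n > 0" and B: "B \<in> sets borel"
  defines "p \<equiv> \<lambda>k. (1 + \<nu> \<bullet> bloch (r k) / norm \<nu>) / 2"
  shows "range p \<subseteq> {0..1}"
    and "measure (law (tensor_algebra r) product_state (spin_mean r \<nu> n)) B = bern_prob (norm \<nu>) p n B"
proof -
  show p: "range p \<subseteq> {0..1}"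
  proof -
    have "\<bar>\<nu> \<bullet> bloch (r k) / norm \<nu>\<bar> \<le> 1" for k
      using inner_bloch_bound[OF r, of \<nu> k] \<nu> by (simp add: abs_divide)
    then have "0 \<le> p k \<and> p k \<le> 1" for k
      unfolding p_def abs_le_iff by (smt (verit) divide_nonneg_pos divide_le_eq_1_pos)
    then show ?thesis by auto
  qed
  let ?E = "\<lambda>U. site_prod r (\<lambda>k. spin_proj \<nu> (k \<in> U)) n"
  have bl: "bounded_linear T" if "T \<in> tensor_algebra r" for T
    using that tensor_algebra_bounded by (auto simp: bounded_operators_def)
  interpret finite_spectral_resolution "spin_mean r \<nu> n" "Pow {..<n}" ?E "spin_val (norm \<nu>) n"
  proof (rule finite_spectral_resolution.intro)
    show "finite (Pow {..<n})" by simp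
    show "bounded_linear (spin_mean r \<nu> n)"
      unfolding spin_mean_eq
      by (intro bounded_linear_const_scaleR bounded_linear_sum bl site_op_in_tensor_algebra)
    show "bounded_linear (?E U)" for U by (rule bl[OF site_prod_in_tensor_algebra])
    show "(\<Sum>U\<in>Pow {..<n}. ?E U \<psi>) = \<psi>" for \<psi>
      by (rule sum_site_prod[OF r spin_proj_sum])
    show "spin_mean r \<nu> n (?E U \<psi>) = spin_val (norm \<nu>) n U *\<^sub>R ?E U \<psi>" if "U \<in> Pow {..<n}" for U \<psi>
    proof -
      have "site_op r k (spin_matrix \<nu>) (?E U \<psi>) = (if k \<in> U then norm \<nu> else - norm \<nu>) *\<^sub>R ?E U \<psi>" if "k < n" for k
        by (rule site_op_site_prod[OF r spin_matrix_proj[OF \<nu>] that])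
      then have "spin_mean r \<nu> n (?E U \<psi>)
          = (1 / real n) *\<^sub>R (\<Sum>k<n. (if k \<in> U then norm \<nu> else - norm \<nu>) *\<^sub>R ?E U \<psi>)"
        by (simp add: spin_mean_eq)
      also have "\<dots> = ((1 / real n) * (\<Sum>k<n. if k \<in> U then norm \<nu> else - norm \<nu>)) *\<^sub>R ?E U \<psi>"
        by (simp only: scaleR_sum_left[symmetric] scaleR_scaleR)
      also have "(1 / real n) * (\<Sum>k<n. if k \<in> U then norm \<nu> else - norm \<nu>) = spin_val (norm \<nu>) n U"
        using sum_spins[of U n "norm \<nu>"] that by (simp add: spin_val_def)
      finally show ?thesis .
    qed
  qed
  have weight: "product_state (?E U) = complex_of_real (bern p n U)" if "U \<in> Pow {..<n}" for U
  proof -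
    have "{..<n} \<inter> U = U" "{..<n} \<inter> - U = {..<n} - U" using that by auto
    then have "bern p n U = (\<Prod>k<n. if k \<in> U then p k else 1 - p k)"
      by (simp add: bern_def prod.If_cases)
    moreover have "product_state (?E U) = (\<Prod>k<n. complex_of_real (if k \<in> U then p k else 1 - p k))"
      unfolding product_state_site_prod[OF r] by (simp only: trace_spin_proj[OF r] p_def)
    ultimately show ?thesis by (simp only: of_real_prod)
  qed
  have "measure (law (tensor_algebra r) product_state (spin_mean r \<nu> n)) B
      = (\<Sum>U | U \<in> Pow {..<n} \<and> spin_val (norm \<nu>) n U \<in> B. bern p n U)"
  proof (rule measure_law[OF bl _ _ _ _ B])
    show "(\<lambda>\<psi>. \<Sum>U\<in>Pow {..<n}. c U *\<^sub>R ?E U \<psi>) \<in> tensor_algebra r" for c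
      by (rule tensor_algebra_sum) (rule site_prod_in_tensor_algebra)
    show "product_state (\<lambda>\<psi>. \<Sum>U\<in>Pow {..<n}. c U *\<^sub>R ?E U \<psi>)
        = complex_of_real (\<Sum>U\<in>Pow {..<n}. c U * bern p n U)" for c
      unfolding product_state_sum by (simp add: weight)
    show "\<forall>U\<in>Pow {..<n}. 0 \<le> bern p n U" using bern_nonneg[OF p] by blast
    show "(\<Sum>U\<in>Pow {..<n}. bern p n U) = 1" by (rule sum_bern)
  qed
  then show "measure (law (tensor_algebra r) product_state (spin_mean r \<nu> n)) B = bern_prob (norm \<nu>) p n B"
    by (simp add: bern_prob_def)
qed

theorem theorem5p1:
  fixes \<Phi> :: "complex^2^2 \<Rightarrow> complex^2^2"
    and \<rho> \<rho>_inf :: "complex^2^2"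
    and \<alpha> :: real and \<beta> :: complex
    and v \<nu> :: "real^3"
  assumes "complex_linear \<Phi>"
    and "completely_positive \<Phi>"
    and "trace_preserving \<Phi>"
    and "\<rho>_inf = vector [vector [complex_of_real \<alpha>, \<beta>], vector [cnj \<beta>, 1 - complex_of_real \<alpha>]]"
    and "density_matrix \<rho>_inf"
    and "\<And>\<tau>. density_matrix \<tau> \<Longrightarrow> (\<lambda>n. (\<Phi> ^^ n) \<tau>) \<longlonglongrightarrow> \<rho>_inf"
    and "v = vector [2 * Re \<beta>, - 2 * Im \<beta>, 2 * \<alpha> - 1]"
    and "density_matrix \<rho>"
    and "\<nu> \<noteq> 0"
  defines "r \<equiv> \<lambda>k. (\<Phi> ^^ k) \<rho>"
  shows "large_deviation_principle
           (\<lambda>n. law (tensor_algebra r) product_state (spin_mean r \<nu> n))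
           real
           (spin_rate \<nu> v)"
proof -
  have r: "density_matrix (r k)" for k
    unfolding r_def using assms density_matrix_iterate by blast
  have lim: "r \<longlonglongrightarrow> \<rho>_inf" unfolding r_def using assms by blast
  have v: "v = bloch \<rho>_inf" using assms by (simp add: bloch_def)
  interpret spin_direction \<nu> v
    by standard (use assms(9) v inner_bloch_bound[OF assms(5)] in blast)+
  define p where "p = (\<lambda>k. (1 + \<nu> \<bullet> bloch (r k) / norm \<nu>) / 2)"
  have "(\<lambda>k. \<nu> \<bullet> bloch (r k)) \<longlonglongrightarrow> \<nu> \<bullet> bloch \<rho>_inf"
    unfolding inner_bloch by (intro tendsto_intros lim)
  then have "p \<longlonglongrightarrow> q"
    unfolding p_def q_def unfolding v using \<open>\<nu> \<noteq> 0\<close>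
    by (intro tendsto_add tendsto_divide tendsto_const) auto
  moreover have "range p \<subseteq> {0..1}"
    \<comment> \<open>The bounds on \<open>p\<close> do not depend on the number of sites or the
      Borel set; 1 and \<open>{}\<close> are convenient instances.\<close>
    using measure_law_spin_mean(1)[OF r \<open>\<nu> \<noteq> 0\<close>, of 1 "{}"] by (simp add: p_def)
  ultimately show ?thesis
    using measure_law_spin_mean(2)[OF r \<open>\<nu> \<noteq> 0\<close>]
    by (intro bernoulli_large_deviations[of p]) (simp_all add: p_def R_def)
qed

end
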